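(* Let $P$ be a finite pree satisfying Axioms A(4) and A(5). Then the universal group $U(P)$ is biautomatic.
   Context: A pree is a set $P$ with a partial multiplication such that: there is an identity $1\in P$ (for all $a\in P$, $1a$ and $a1$ are defined and equal $a$); every $a\in P$ has a two-sided inverse $a^{-1}\in P$ ($aa^{-1}$ and $a^{-1}a$ are defined and equal $1$); and the associative law holds: if $ab$ and $bc$ are defined, then $(ab)c$ is defined if and only if $a(bc)$ is defined, and when they are defined $(ab)c=a(bc)$. Axiom A(4): whenever $a_1,\dots,a_4\in P$ are such that the products $a_1^{-1}a_2=b_1$, $a_2^{-1}a_3=b_2$, $a_3^{-1}a_4=b_3$, $a_4^{-1}a_1=b_4$ are all defined, at least one of the products $b_ib_{i+1}$ (indices modulo 4) is defined. Axiom A(5): whenever $a_1,\dots,a_5\in P$ are such that the products $a_1^{-1}a_2=b_1$, $a_2^{-1}a_3=b_2$, $a_3^{-1}a_4=b_3$, $a_4^{-1}a_5=b_4$, $a_5^{-1}a_1=b_5$ are all defined, at least one of the products $b_ib_{i+1}$ (indices modulo 5) is defined. The universal group $U(P)$ is the group with generating set $P$ and relators $abc^{-1}$ for every product $ab=c$ defined in $P$. Biautomatic has its standard meaning: for a finite generating set closed under inverses there is a regular language $L$ of words over the generators mapping onto the group, and a constant $K$, such that any two paths in the Cayley graph with labels in $L$ which begin at distance at most one apart and end at distance at most one apart synchronously $K$-fellow travel. *)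

theory Defs
  imports "HOL-Algebra.Generated_Groups"
begin

section \<open>Prees\<close>

text \<open>A partial multiplication is encoded by \<open>pmult\<close>: the product of \<open>a\<close> and \<open>b\<close> is defined
  and equal to \<open>c\<close> iff \<open>pmult P a b = Some c\<close>. Values of \<open>pmult\<close> outside the carrier are never
  used.\<close>

record 'a partial_magma = "'a partial_object" +
  pmult :: "'a \<Rightarrow> 'a \<Rightarrow> 'a option"
  pone :: 'a

text \<open>In \<open>assoc\<close>, the products \<open>ab = x\<close> and \<open>bc = y\<close> are defined. The equation between
  options then says that \<open>xc\<close> is defined iff \<open>ay\<close> is, and that they agree when defined.\<close>

locale pree =
  fixes P :: "('a, 'more) partial_magma_scheme" (structure)
  assumes closed: "\<lbrakk>a \<in> carrier P; b \<in> carrier P; pmult P a b = Some c\<rbrakk> \<Longrightarrow> c \<in> carrier P"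
    and one_closed: "pone P \<in> carrier P"
    and one_left: "a \<in> carrier P \<Longrightarrow> pmult P (pone P) a = Some a"
    and one_right: "a \<in> carrier P \<Longrightarrow> pmult P a (pone P) = Some a"
    and ex_inverse: "a \<in> carrier P \<Longrightarrow>
      \<exists>a' \<in> carrier P. pmult P a a' = Some (pone P) \<and> pmult P a' a = Some (pone P)"
    and assoc: "\<lbrakk>a \<in> carrier P; b \<in> carrier P; c \<in> carrier P;
      pmult P a b = Some x; pmult P b c = Some y\<rbrakk> \<Longrightarrow> pmult P x c = pmult P a y"

definition pinv :: "('a, 'more) partial_magma_scheme \<Rightarrow> 'a \<Rightarrow> 'a" where
  "pinv P a = (THE a'. a' \<in> carrier P \<and>
     pmult P a a' = Some (pone P) \<and> pmult P a' a = Some (pone P))"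

lemma (in pree) ex1_inverse:
  assumes "a \<in> carrier P"
  shows "\<exists>!a'. a' \<in> carrier P \<and> pmult P a a' = Some (pone P) \<and> pmult P a' a = Some (pone P)"
proof -
  have "x = y" if "x \<in> carrier P" "y \<in> carrier P" "pmult P x a = Some (pone P)"
    "pmult P a y = Some (pone P)" for x y
    using assoc[OF that(1) assms that(2,3,4)] that(1,2) by (simp add: one_left one_right)
  then show ?thesis using ex_inverse[OF assms] by blast
qed

lemma (in pree) pinv:
  assumes "a \<in> carrier P"
  shows "pinv P a \<in> carrier P" "pmult P a (pinv P a) = Some (pone P)"
    "pmult P (pinv P a) a = Some (pone P)"
  using theI'[OF ex1_inverse[OF assms], folded pinv_def] by simp_all

text \<open>Axiom \<open>A(n)\<close>, with the indices \<open>1, \<dots>, n\<close> shifted to \<open>0, \<dots>, n - 1\<close>.\<close>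

definition axiom_A :: "('a, 'more) partial_magma_scheme \<Rightarrow> nat \<Rightarrow> bool" where
  "axiom_A P n \<longleftrightarrow>
     (\<forall>a b :: nat \<Rightarrow> 'a.
        (\<forall>i<n. a i \<in> carrier P) \<and>
        (\<forall>i<n. pmult P (pinv P (a i)) (a ((i + 1) mod n)) = Some (b i)) \<longrightarrow>
        (\<exists>i<n. pmult P (b i) (b ((i + 1) mod n)) \<noteq> None))"


section \<open>Groups given by generators and relators\<close>

text \<open>The letter \<open>(x, True)\<close> stands for the generator \<open>x\<close> and \<open>(x, False)\<close> for its formal
  inverse.\<close>

type_synonym 'a letter = "'a \<times> bool"

abbreviation group_words :: "'a set \<Rightarrow> 'a letter list set" where
  "group_words X \<equiv> lists (X \<times> UNIV)"

definition inv_letter :: "'a letter \<Rightarrow> 'a letter" where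
  "inv_letter l = (fst l, \<not> snd l)"

inductive_set pres_rel :: "'a set \<Rightarrow> 'a letter list set \<Rightarrow> ('a letter list \<times> 'a letter list) set"
  for X :: "'a set" and R :: "'a letter list set" where
  refl: "w \<in> group_words X \<Longrightarrow> (w, w) \<in> pres_rel X R"
| sym: "(v, w) \<in> pres_rel X R \<Longrightarrow> (w, v) \<in> pres_rel X R"
| trans: "\<lbrakk>(u, v) \<in> pres_rel X R; (v, w) \<in> pres_rel X R\<rbrakk> \<Longrightarrow> (u, w) \<in> pres_rel X R"
| cancel: "\<lbrakk>u \<in> group_words X; v \<in> group_words X; l \<in> X \<times> UNIV\<rbrakk>
    \<Longrightarrow> (u @ [l, inv_letter l] @ v, u @ v) \<in> pres_rel X R"
| relator: "\<lbrakk>u \<in> group_words X; v \<in> group_words X; r \<in> R; r \<in> group_words X\<rbrakk>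
    \<Longrightarrow> (u @ r @ v, u @ v) \<in> pres_rel X R"

definition presented_group :: "'a set \<Rightarrow> 'a letter list set \<Rightarrow> 'a letter list set monoid" where
  "presented_group X R =
     \<lparr>carrier = group_words X // pres_rel X R,
      mult = (\<lambda>A B. \<Union>u\<in>A. \<Union>v\<in>B. pres_rel X R `` {u @ v}),
      one = pres_rel X R `` {[]}\<rparr>"

definition universal_group :: "('a, 'more) partial_magma_scheme \<Rightarrow> 'a letter list set monoid" where
  "universal_group P = presented_group (carrier P)
     {[(a, True), (b, True), (c, False)] | a b c.
        a \<in> carrier P \<and> b \<in> carrier P \<and> pmult P a b = Some c}"

lemma pres_rel_words:
  "(v, w) \<in> pres_rel X R \<Longrightarrow> v \<in> group_words X \<and> w \<in> group_words X"
  by (induction rule: pres_rel.induct) (auto simp: inv_letter_def)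

lemma equiv_pres_rel: "equiv (group_words X) (pres_rel X R)"
proof (rule equivI)
  show "pres_rel X R \<subseteq> group_words X \<times> group_words X"
    by (auto dest: pres_rel_words)
  show "refl_on (group_words X) (pres_rel X R)"
    by (auto intro!: refl_onI pres_rel.refl)
  show "Relation.sym (pres_rel X R)" by (auto intro: symI pres_rel.sym)
  show "Relation.trans (pres_rel X R)" by (auto intro: transI pres_rel.trans)
qed

lemma pres_rel_context:
  assumes "(v, w) \<in> pres_rel X R" "p \<in> group_words X" "s \<in> group_words X"
  shows "(p @ v @ s, p @ w @ s) \<in> pres_rel X R"
  using assms(1)
proof (induction rule: pres_rel.induct)
  case (refl w)
  then show ?case using assms by (intro pres_rel.refl) auto
next
  case (sym v w)
  then show ?case by (blast intro: pres_rel.sym)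
next
  case (trans u v w)
  then show ?case by (blast intro: pres_rel.trans)
next
  case (cancel u v l)
  then show ?case using assms pres_rel.cancel[of "p @ u" X "v @ s" l R] by simp
next
  case (relator u v r)
  then show ?case using assms pres_rel.relator[of "p @ u" X "v @ s" r R] by simp
qed

lemma pres_rel_append:
  assumes "(v, v') \<in> pres_rel X R" "(w, w') \<in> pres_rel X R"
  shows "(v @ w, v' @ w') \<in> pres_rel X R"
proof (rule pres_rel.trans)
  show "(v @ w, v' @ w) \<in> pres_rel X R"
    using pres_rel_context[OF assms(1), of "[]" w] pres_rel_words[OF assms(2)] by simp
  show "(v' @ w, v' @ w') \<in> pres_rel X R"
    using pres_rel_context[OF assms(2), of v' "[]"] pres_rel_words[OF assms(1)] by simp
qed

lemma inv_letter_words: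
  "w \<in> group_words X \<Longrightarrow> map inv_letter (rev w) \<in> group_words X"
  by (induction w) (auto simp: inv_letter_def)

lemma presented_group_mult:
  assumes "v \<in> group_words X" "w \<in> group_words X"
  shows "pres_rel X R `` {v} \<otimes>\<^bsub>presented_group X R\<^esub> pres_rel X R `` {w} = pres_rel X R `` {v @ w}"
proof -
  have "congruent2 (pres_rel X R) (pres_rel X R) (\<lambda>v w. pres_rel X R `` {v @ w})"
    by (auto intro!: congruent2I' equiv_class_eq[OF equiv_pres_rel] pres_rel_append)
  from UN_equiv_class2[OF equiv_pres_rel equiv_pres_rel this assms]
  show ?thesis by (simp add: presented_group_def)
qed

lemma pres_rel_inverse:
  assumes "w \<in> group_words X"
  shows "(map inv_letter (rev w) @ w, []) \<in> pres_rel X R"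
  using assms
proof (induction w rule: list.induct)
  case Nil
  then show ?case by (auto intro: pres_rel.refl)
next
  case (Cons l w)
  have w: "w \<in> group_words X" using Cons.prems by simp
  note words = inv_letter_words[OF w] w
  have "(map inv_letter (rev w) @ [inv_letter l, inv_letter (inv_letter l)] @ w,
      map inv_letter (rev w) @ w) \<in> pres_rel X R"
    using words Cons.prems by (intro pres_rel.cancel) (auto simp: inv_letter_def)
  then have "(map inv_letter (rev (l # w)) @ l # w, map inv_letter (rev w) @ w) \<in> pres_rel X R"
    by (simp add: inv_letter_def)
  then show ?case using Cons.IH[OF w] by (rule pres_rel.trans)
qed

theorem group_presented_group: "group (presented_group X R)"
proof (rule groupI)
  let ?G = "presented_group X R"
  have car: "carrier ?G = group_words X // pres_rel X R"
    and one: "\<one>\<^bsub>?G\<^esub> = pres_rel X R `` {[]}"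
    by (simp_all add: presented_group_def)
  show "\<one>\<^bsub>?G\<^esub> \<in> carrier ?G" by (auto simp: car one intro: quotientI)
  show "x \<otimes>\<^bsub>?G\<^esub> y \<in> carrier ?G" if "x \<in> carrier ?G" "y \<in> carrier ?G" for x y
    using that unfolding car
    by (elim quotientE) (simp add: presented_group_mult quotientI)
  show "x \<otimes>\<^bsub>?G\<^esub> y \<otimes>\<^bsub>?G\<^esub> z = x \<otimes>\<^bsub>?G\<^esub> (y \<otimes>\<^bsub>?G\<^esub> z)"
    if "x \<in> carrier ?G" "y \<in> carrier ?G" "z \<in> carrier ?G" for x y z
    using that unfolding car
    by (elim quotientE) (simp add: presented_group_mult)
  show "\<one>\<^bsub>?G\<^esub> \<otimes>\<^bsub>?G\<^esub> x = x" if "x \<in> carrier ?G" for x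
    using that unfolding car one
    by (elim quotientE) (simp add: presented_group_mult)
  show "\<exists>y\<in>carrier ?G. y \<otimes>\<^bsub>?G\<^esub> x = \<one>\<^bsub>?G\<^esub>" if x: "x \<in> carrier ?G" for x
  proof -
    obtain w where w: "w \<in> group_words X" "x = pres_rel X R `` {w}"
      using x unfolding car by (elim quotientE)
    let ?v = "map inv_letter (rev w)"
    have v: "?v \<in> group_words X" using w by (intro inv_letter_words)
    have "pres_rel X R `` {?v} \<otimes>\<^bsub>?G\<^esub> x = \<one>\<^bsub>?G\<^esub>"
      unfolding w(2) one presented_group_mult[OF v w(1)]
      using equiv_class_eq[OF equiv_pres_rel pres_rel_inverse[OF w(1)]] .
    then show ?thesis using quotientI[OF v] unfolding car by blast
  qed
qed

corollary group_universal_group: "group (universal_group P)"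
  unfolding universal_group_def by (rule group_presented_group)


section \<open>Biautomatic groups\<close>

text \<open>The states of a finite automaton may be taken to be natural numbers.\<close>

definition regular_language :: "'b set \<Rightarrow> 'b list set \<Rightarrow> bool" where
  "regular_language A L \<longleftrightarrow>
     (\<exists>(Q :: nat set) q0 F (\<delta> :: nat \<Rightarrow> 'b \<Rightarrow> nat).
        finite Q \<and> q0 \<in> Q \<and> F \<subseteq> Q \<and> (\<forall>q\<in>Q. \<forall>x\<in>A. \<delta> q x \<in> Q) \<and>
        L = {w \<in> lists A. foldl \<delta> q0 w \<in> F})"

definition word_value :: "('g, 'm) monoid_scheme \<Rightarrow> 'g list \<Rightarrow> 'g" where
  "word_value G w = foldr (mult G) w \<one>\<^bsub>G\<^esub>"

text \<open>Distance in the Cayley graph, whose edges join \<open>g\<close> to \<open>g \<otimes> a\<close> for \<open>a \<in> A\<close>. It is used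
  only for a generating set \<open>A\<close> closed under inverses, so that the set of lengths is nonempty.\<close>

definition cayley_dist :: "('g, 'm) monoid_scheme \<Rightarrow> 'g set \<Rightarrow> 'g \<Rightarrow> 'g \<Rightarrow> nat" where
  "cayley_dist G A g h =
     (LEAST n. \<exists>w \<in> lists A. length w = n \<and> g \<otimes>\<^bsub>G\<^esub> word_value G w = h)"

text \<open>The vertex reached at time \<open>t\<close> by the path from \<open>g\<close> with label \<open>w\<close>; from time
  \<open>length w\<close> on, the path stays at its end point.\<close>

definition path_at :: "('g, 'm) monoid_scheme \<Rightarrow> 'g \<Rightarrow> 'g list \<Rightarrow> nat \<Rightarrow> 'g" where
  "path_at G g w t = g \<otimes>\<^bsub>G\<^esub> word_value G (take t w)"

definition fellow_travel ::
  "('g, 'm) monoid_scheme \<Rightarrow> 'g set \<Rightarrow> nat \<Rightarrow> 'g \<Rightarrow> 'g list \<Rightarrow> 'g \<Rightarrow> 'g list \<Rightarrow> bool" where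
  "fellow_travel G A K g u h v \<longleftrightarrow>
     (\<forall>t. cayley_dist G A (path_at G g u t) (path_at G h v t) \<le> K)"

definition biautomatic :: "('g, 'm) monoid_scheme \<Rightarrow> bool" where
  "biautomatic G \<longleftrightarrow> group G \<and>
     (\<exists>A L K.
        finite A \<and> A \<subseteq> carrier G \<and> (\<forall>a\<in>A. inv\<^bsub>G\<^esub> a \<in> A) \<and> generate G A = carrier G \<and>
        regular_language A L \<and> word_value G ` L = carrier G \<and>
        (\<forall>u\<in>L. \<forall>v\<in>L. \<forall>g\<in>carrier G. \<forall>h\<in>carrier G.
           cayley_dist G A g h \<le> 1 \<and>
           cayley_dist G A (path_at G g u (length u)) (path_at G h v (length v)) \<le> 1 \<longrightarrow>
           fellow_travel G A K g u h v))"

end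

theory Submission
  imports Defs
begin

text \<open>The axioms \<open>A(4)\<close> and \<open>A(5)\<close> say that the links in the flag complex of the Cayley graph of
  \<open>U(P)\<close> with respect to \<open>P\<close> contain no full cycles of length 4 or 5. As the complex is simply
  connected, it is systolic; equivalently, the graph is bridged: the neighbours of a vertex \<open>x\<close> which
  are closer to a base vertex \<open>u\<close> than \<open>x\<close> form a clique, and adjacent vertices at equal distance from
  \<open>u\<close> have a common neighbour which is closer to \<open>u\<close>. This passage from local to global is carried out
  without diagrams: the graph is constructed ball by ball around a base vertex (Weetman), \<open>P\<close> acts
  on the result, and the action identifies it with the Cayley graph.

  In a bridged graph every clique in a sphere around \<open>u\<close> projects to a clique in the next smaller
  sphere, namely its common lower neighbours. The language consists of the labels of the paths from
  \<open>w\<close> to \<open>u\<close> which follow the iterated projections of \<open>{w}\<close>, the directed geodesics of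
  Januszkiewicz and Swiatkowski. For adjacent starting points \<open>w\<close> the current simplices, once on the
  same sphere, alternately span a clique or meet. For adjacent targets \<open>u\<close> they span a clique, because
  geodesics from one vertex to two adjacent ones cannot diverge.\<close>

section \<open>Partial multiplication and links\<close>

text \<open>The link conditions cannot be read in the Cayley graph of \<open>U\<close> directly: it
  is not known beforehand that \<open>P\<close> embeds in \<open>U\<close>, nor that a product which
  lands in \<open>P\<close> inside \<open>U\<close> is already defined in \<open>P\<close>. Hence
  the graph is made from \<open>P\<close> alone, and both facts come out afterwards
  (\<open>gen_mult_iff\<close>). All spheres met by an itinerary are centred at its target, so
  moving the start and moving the target are different problems. Two paths are compared through the
  itinerary with one start and the other target. Moving the start costs 3: 2 between meeting
  simplices, 1 for a delay of one step when the starts lie on different spheres. Moving the target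
  costs 2: 1 for each of two moves through a vertex one step nearer to the start. The sum is the
  constant 5. An automaton reading a path does not know how far the target is. It only needs the
  generators that shorten the current vertex. These are determined by the unread part of the word,
  so they are guessed and checked against the end of the word; this is why the automaton is
  nondeterministic.\<close>

context pree
begin

definition mul :: "'a \<Rightarrow> 'a \<Rightarrow> 'a \<Rightarrow> bool" where
  "mul a b c \<longleftrightarrow> a \<in> carrier P \<and> b \<in> carrier P \<and> pmult P a b = Some c"

text \<open>This says that \<open>pinv P a\<close> times \<open>b\<close> is defined: adjacency of
  two neighbours of a vertex, reached from it by \<open>a\<close> and by \<open>b\<close>.\<close>

definition linked :: "'a \<Rightarrow> 'a \<Rightarrow> bool" where
  "linked a b \<longleftrightarrow> (\<exists>x. mul a x b)"

lemma mul_carrier: "mul a b c \<Longrightarrow> a \<in> carrier P \<and> b \<in> carrier P \<and> c \<in> carrier P"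
  unfolding mul_def using closed[of a b c] by simp

lemma mul_unique: "mul a b c \<Longrightarrow> mul a b c' \<Longrightarrow> c = c'"
  by (simp add: mul_def)

lemma mul_one_left: "a \<in> carrier P \<Longrightarrow> mul (pone P) a a"
  by (simp add: mul_def one_closed one_left)

lemma mul_one_right: "a \<in> carrier P \<Longrightarrow> mul a (pone P) a"
  by (simp add: mul_def one_closed one_right)

lemma mul_pinv: "a \<in> carrier P \<Longrightarrow> mul a (pinv P a) (pone P)" "a \<in> carrier P \<Longrightarrow> mul (pinv P a) a (pone P)"
  by (simp_all add: mul_def pinv)

lemma pinv_carrier: "a \<in> carrier P \<Longrightarrow> pinv P a \<in> carrier P"
  by (rule pinv)

lemma mul_assoc:
  assumes "mul a b x" "mul b c y"
  shows "mul x c z \<longleftrightarrow> mul a y z"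
proof -
  have "pmult P x c = pmult P a y" using assms assoc[of a b c x y] unfolding mul_def by blast
  then show ?thesis
    using mul_carrier[OF assms(1)] mul_carrier[OF assms(2)] unfolding mul_def by simp
qed

lemma mul_cancel_left: "mul a b c \<Longrightarrow> mul (pinv P a) c b"
  using mul_assoc[OF mul_pinv(2), of a b c b] mul_carrier[of a b c] mul_one_left[of b] by simp

lemma mul_cancel_right: "mul a b c \<Longrightarrow> mul c (pinv P b) a"
  using mul_assoc[OF _ mul_pinv(1), of a b c a] mul_carrier[of a b c] mul_one_right[of a] by simp

lemma mul_left_unique: "mul a b c \<Longrightarrow> mul a b' c \<Longrightarrow> b = b'"
  by (rule mul_unique[OF mul_cancel_left mul_cancel_left])

lemma pinv_pinv: "a \<in> carrier P \<Longrightarrow> pinv P (pinv P a) = a"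
  by (rule mul_left_unique[OF mul_pinv(1)[OF pinv_carrier] mul_pinv(2)])

lemma pinv_one: "pinv P (pone P) = pone P"
  using mul_left_unique[OF mul_pinv(1)[OF one_closed] mul_one_left[OF one_closed]] .

lemma mul_cancel_left': "mul (pinv P a) c b \<Longrightarrow> a \<in> carrier P \<Longrightarrow> mul a b c"
  using mul_cancel_left[of "pinv P a" c b] pinv_pinv by simp

lemma mul_inverse: "mul a b c \<Longrightarrow> mul (pinv P b) (pinv P a) (pinv P c)"
  by (rule mul_cancel_left[OF mul_cancel_right[OF mul_cancel_left]])

lemma linked_refl: "a \<in> carrier P \<Longrightarrow> linked a a"
  unfolding linked_def using mul_one_right[of a] by (rule exI)

lemma linked_sym: "linked a b \<Longrightarrow> linked b a"
  using mul_cancel_right by (auto simp: linked_def)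

text \<open>The elements \<open>b i\<close> of the axiom label the sides of the cycle. If two
  consecutive labels can be multiplied, associativity turns their product into the label of the
  diagonal that cuts off the vertex between them.\<close>

lemma linked_cycle:
  assumes ax: "axiom_A P n" and len: "length xs = n" "0 < n"
    and cyc: "\<And>i. i < n \<Longrightarrow> linked (xs ! i) (xs ! ((i + 1) mod n))"
  obtains i where "i < n" "linked (xs ! i) (xs ! ((i + 2) mod n))"
proof -
  have "\<exists>y. mul (xs ! i) y (xs ! ((i + 1) mod n))" if "i < n" for i
    using cyc[OF that] by (simp add: linked_def)
  then obtain b where b: "\<And>i. i < n \<Longrightarrow> mul (xs ! i) (b i) (xs ! ((i + 1) mod n))" by metis
  have "\<forall>i<n. pmult P (pinv P (xs ! i)) (xs ! ((i + 1) mod n)) = Some (b i)"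
    using mul_cancel_left[OF b] unfolding mul_def by simp
  moreover have "\<forall>i<n. xs ! i \<in> carrier P" using b by (auto simp: mul_def)
  ultimately obtain i where i: "i < n" "pmult P (b i) (b ((i + 1) mod n)) \<noteq> None"
    using ax unfolding axiom_A_def by blast
  let ?j = "(i + 1) mod n"
  have j: "?j < n" using len by simp
  obtain z where "mul (b i) (b ?j) z"
    using i b[OF i(1)] b[OF j] by (auto simp: mul_def)
  then have "mul (xs ! i) z (xs ! ((?j + 1) mod n))"
    using mul_assoc[OF b[OF i(1)]] b[OF j] by blast
  moreover have "(?j + 1) mod n = (i + 2) mod n" by (simp add: mod_Suc_eq)
  ultimately have "linked (xs ! i) (xs ! ((i + 2) mod n))" by (auto simp: linked_def)
  then show thesis using that i(1) by blast
qed

lemma linked_cycle4: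
  assumes "axiom_A P 4" "linked a b" "linked b c" "linked c e" "linked e a"
  shows "linked a c \<or> linked b e"
proof -
  have "linked ([a,b,c,e] ! i) ([a,b,c,e] ! ((i + 1) mod 4))" if "i < 4" for i
  proof -
    have "i = 0 \<or> i = 1 \<or> i = 2 \<or> i = 3" using that by linarith
    then show ?thesis using assms by auto
  qed
  then obtain i where i: "i < 4" "linked ([a,b,c,e] ! i) ([a,b,c,e] ! ((i + 2) mod 4))"
    using linked_cycle[OF assms(1), of "[a,b,c,e]"] by auto
  then have "i = 0 \<or> i = 1 \<or> i = 2 \<or> i = 3" by linarith
  then show ?thesis using i(2) linked_sym by auto
qed

lemma linked_cycle5:
  assumes "axiom_A P 5" "linked a b" "linked b c" "linked c e" "linked e f" "linked f a"
  shows "linked a c \<or> linked b e \<or> linked c f \<or> linked e a \<or> linked f b"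
proof -
  have "linked ([a,b,c,e,f] ! i) ([a,b,c,e,f] ! ((i + 1) mod 5))" if "i < 5" for i
  proof -
    have "i = 0 \<or> i = 1 \<or> i = 2 \<or> i = 3 \<or> i = 4" using that by linarith
    then show ?thesis using assms by auto
  qed
  then obtain i where i: "i < 5" "linked ([a,b,c,e,f] ! i) ([a,b,c,e,f] ! ((i + 2) mod 5))"
    using linked_cycle[OF assms(1), of "[a,b,c,e,f]"] by auto
  then have "i = 0 \<or> i = 1 \<or> i = 2 \<or> i = 3 \<or> i = 4" by linarith
  then show ?thesis using i(2) by auto
qed

end

section \<open>Construction of the Cayley graph ball by ball\<close>

text \<open>The vertices of the ball of radius \<open>n\<close> are represented by all geodesic words leading to them
  from the centre: \<open>E u x t\<close> means that \<open>t\<close> spells the vertex reached from \<open>u\<close> by \<open>x\<close>, so that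
  \<open>u\<close> and \<open>t\<close> spell the same vertex iff \<open>E u (pone P) t\<close>.\<close>

locale ball = pree P for P :: "('a, 'more) partial_magma_scheme" (structure) +
  fixes n :: nat and S :: "'a list set" and E :: "'a list \<Rightarrow> 'a \<Rightarrow> 'a list \<Rightarrow> bool"
  assumes E_dom: "E u x t \<Longrightarrow> u \<in> S \<and> x \<in> carrier P \<and> t \<in> S"
    and S_lists: "u \<in> S \<Longrightarrow> u \<in> lists (carrier P) \<and> length u \<le> n"
    and Nil_S: "[] \<in> S"
    and E_refl: "u \<in> S \<Longrightarrow> E u (pone P) u"
    and E_tri: "E u x t \<Longrightarrow> E u y v \<Longrightarrow> mul x z y \<Longrightarrow> E t z v"
    and E_uniq: "E u x t \<Longrightarrow> E u y t \<Longrightarrow> x = y"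
    and E_level: "E u x t \<Longrightarrow> length t \<le> Suc (length u)"
    and E_one: "E u (pone P) t \<Longrightarrow> length t = length u"
    and E_total: "u \<in> S \<Longrightarrow> length u < n \<Longrightarrow> x \<in> carrier P \<Longrightarrow> \<exists>t. E u x t"
    and E_down: "E u x t \<Longrightarrow> E u y v \<Longrightarrow> length t < length u \<Longrightarrow> length v < length u \<Longrightarrow> linked x y"
    and E_flat: "E u x t \<Longrightarrow> length t = length u \<Longrightarrow> u \<noteq> [] \<Longrightarrow>
      \<exists>y v. E u y v \<and> length v < length u \<and> linked y x"
    and S_prefix: "w @ [p] \<in> S \<Longrightarrow> E w p (w @ [p])"
begin

lemma E_sym: "E u x t \<Longrightarrow> E t (pinv P x) u"
  using E_tri[OF _ E_refl, of u x t "pinv P x"] E_dom mul_pinv by blast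

lemma E_trans: "E u x t \<Longrightarrow> E t z v \<Longrightarrow> mul x z y \<Longrightarrow> E u y v"
  by (rule E_tri[OF E_sym _ mul_cancel_left])

section \<open>Directions that leave the ball, and the next sphere\<close>

definition free :: "'a list \<Rightarrow> 'a \<Rightarrow> bool" where
  "free u p \<longleftrightarrow> u \<in> S \<and> length u = n \<and> p \<in> carrier P \<and> (\<forall>t. \<not> E u p t)"

lemma free_move:
  assumes "E u h s" "length s = n" "mul h r p" "free u p"
  shows "free s r"
  using E_dom[OF assms(1)] mul_carrier[OF assms(3)] E_trans[OF assms(1) _ assms(3)] assms(2,4)
  unfolding free_def by blast

text \<open>In the link of \<open>u\<close> the directions \<open>a, p, b, y2, y1\<close> form a
  5-cycle, where \<open>y1\<close> and \<open>y2\<close> are lower directions linked to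
  \<open>a\<close> and to \<open>b\<close>. The free direction \<open>p\<close> is linked to no
  lower direction, since words shorter than \<open>n\<close> have all their edges in the ball. So a
  chord is either the desired one or cuts off a 4-cycle through \<open>a, p, b\<close>, whose other
  diagonal again ends at \<open>p\<close>. On the sphere of radius 0 both directions are loops and
  coincide.\<close>

lemma linked_if_free:
  assumes A4: "axiom_A P 4" and A5: "axiom_A P 5"
    and as: "E u a s" "E u b t" "length s = n" "length t = n"
    and free: "free u p" "linked a p" "linked b p"
  shows "linked a b"
proof (cases n)
  case 0
  moreover have "length u = n" using free by (simp add: free_def)
  ultimately have "s = []" "t = []" using as by simp_all
  then have "a = b" using as E_uniq by blast
  then show ?thesis using linked_refl as E_dom by blast
next
  case (Suc m)
  have n: "length u = n" using free by (simp add: free_def)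
  then have ne: "u \<noteq> []" using Suc by auto
  have low: "\<not> linked y p" if yv: "E u y v" "length v < n" for y v
  proof
    assume "linked y p"
    then obtain z where z: "mul y z p" by (auto simp: linked_def)
    then obtain w where "E v z w" using E_total[of v z] yv E_dom[OF yv(1)] mul_carrier[OF z] by blast
    then have "E u p w" by (rule E_trans[OF yv(1) _ z])
    then show False using free by (auto simp: free_def)
  qed
  obtain y1 v1 where y1: "E u y1 v1" "length v1 < n" "linked y1 a"
    using E_flat[OF as(1)] as(3) n ne by auto
  obtain y2 v2 where y2: "E u y2 v2" "length v2 < n" "linked y2 b"
    using E_flat[OF as(2)] as(4) n ne by auto
  have y12: "linked y1 y2" using E_down[OF y1(1) y2(1)] y1 y2 n by simp
  have no: "\<not> linked y1 p" "\<not> linked y2 p" "\<not> linked p y1" "\<not> linked p y2"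
    using low y1 y2 linked_sym by blast+
  have four: "linked a b" if "linked y1 b"
    using linked_cycle4[OF A4 free(2) linked_sym[OF free(3)] linked_sym[OF that] y1(3)] no by blast
  have four': "linked a b" if "linked y2 a"
    using linked_cycle4[OF A4 free(2) linked_sym[OF free(3)] linked_sym[OF y2(3)] that] no by blast
  show ?thesis
    using linked_cycle5[OF A5 free(2) linked_sym[OF free(3)] linked_sym[OF y2(3)] linked_sym[OF y12] y1(3)]
      no four four' linked_sym by blast
qed

text \<open>\<open>up s r v\<close>: the word \<open>v\<close> of length \<open>n + 1\<close> spells the vertex reached from \<open>s\<close> by \<open>r\<close>.\<close>

definition up :: "'a list \<Rightarrow> 'a \<Rightarrow> 'a list \<Rightarrow> bool" where
  "up s r v \<longleftrightarrow> (\<exists>w p h. v = w @ [p] \<and> free w p \<and> length s = n \<and> E w h s \<and> mul h r p)"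

definition S' :: "'a list set" where
  "S' = S \<union> {w @ [p] | w p. free w p}"

text \<open>New words are joined only through a common lower neighbour, so the triangle condition is
  built in. For \<open>x = pone P\<close> the last clause identifies the words that spell the same
  new vertex.\<close>

definition E' :: "'a list \<Rightarrow> 'a \<Rightarrow> 'a list \<Rightarrow> bool" where
  "E' u x t \<longleftrightarrow> E u x t \<or> up u x t \<or> (x \<in> carrier P \<and> up t (pinv P x) u) \<or>
     (\<exists>s r r'. up s r u \<and> up s r' t \<and> mul r x r')"

lemma up_free: "up s r v \<Longrightarrow> free s r"
  unfolding up_def using free_move by blast

lemma up_length: "up s r v \<Longrightarrow> length s = n \<and> length v = Suc n"
  unfolding up_def free_def by auto

lemma up_S: "up s r v \<Longrightarrow> s \<in> S \<and> r \<in> carrier P \<and> v \<in> S'"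
  using up_free unfolding up_def free_def S'_def by blast

lemma up_refl: "free w p \<Longrightarrow> up w p (w @ [p])"
  unfolding up_def using E_refl mul_one_left by (fastforce simp: free_def)

lemma E_length: "E u x t \<Longrightarrow> length u \<le> n \<and> length t \<le> n"
  using E_dom S_lists by blast

lemma E_not_up: "E u x t \<Longrightarrow> \<not> up s r u"
  using E_length up_length by fastforce

lemma up_not_up: "up u x t \<Longrightarrow> \<not> up s r u"
  using up_length[of u x t] up_length[of s r u] by auto

lemma E'_up: "up s r v \<Longrightarrow> E' s r v"
  by (simp add: E'_def)

lemma E'_down: "up s r v \<Longrightarrow> E' v (pinv P r) s"
  using up_S pinv_pinv pinv_carrier by (auto simp: E'_def)

lemma E'_flat: "up s r u \<Longrightarrow> up s r' t \<Longrightarrow> mul r x r' \<Longrightarrow> E' u x t"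
  by (auto simp: E'_def)

lemma E'_cases [consumes 1, case_names old up down flat]:
  assumes "E' u x t"
  obtains "E u x t" | "up u x t" | r where "up t r u" "x = pinv P r" "r \<in> carrier P"
    | s r r' where "up s r u" "up s r' t" "mul r x r'"
  using assms pinv_pinv pinv_carrier unfolding E'_def by metis

end

section \<open>The extended ball under the link axioms\<close>

locale ball46 = ball + assumes A4: "axiom_A P 4" and A5: "axiom_A P 5"
begin

text \<open>Both lower neighbours are seen from the word \<open>w\<close> that \<open>v\<close>
  extends by \<open>p\<close>: their directions are linked to the free direction \<open>p\<close>,
  so \<open>linked_if_free\<close> joins them.\<close>

lemma up_up:
  assumes "up s r v" "up s' r' v"
  obtains h where "E s h s'" "mul h r' r"
proof -
  obtain w p h h' where w: "v = w @ [p]" "free w p" and h: "E w h s" "mul h r p" "length s = n"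
    and h': "E w h' s'" "mul h' r' p" "length s' = n"
    using assms unfolding up_def by fastforce
  have "linked h h'"
    using linked_if_free[OF A4 A5 h(1) h'(1) h(3) h'(3) w(2)] h h' by (auto simp: linked_def)
  then obtain k where k: "mul h k h'" by (auto simp: linked_def)
  have "E s k s'" using E_tri[OF h(1) h'(1) k] .
  moreover have "mul k r' r"
    using mul_assoc[OF mul_cancel_left[OF k] h'(2)] mul_cancel_left[OF h(2)] by blast
  ultimately show thesis using that by blast
qed

text \<open>Shows that being below \<open>v\<close> does not depend on the way \<open>v\<close> is
  spelled. At \<open>s\<close> the directions back to \<open>w\<close> and on to \<open>s'\<close>
  are both linked to the free direction \<open>r\<close>, so \<open>s'\<close> is a neighbour of
  \<open>w\<close> as well.\<close>

lemma up_move: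
  assumes "up s r v" "E s h s'" "length s' = n" "mul h r' r"
  shows "up s' r' v"
proof -
  obtain w p k where w: "v = w @ [p]" "free w p" and k: "E w k s" "mul k r p" "length s = n"
    using assms unfolding up_def by blast
  have "linked (pinv P k) h"
  proof (rule linked_if_free[OF A4 A5 E_sym[OF k(1)] assms(2)])
    show "length w = n" using w by (simp add: free_def)
    show "length s' = n" by fact
    show "free s r" using up_free assms by blast
    show "linked (pinv P k) r" using mul_cancel_left[OF k(2)] unfolding linked_def by blast
    show "linked h r" using assms by (auto simp: linked_def)
  qed
  then obtain l where l: "mul (pinv P k) l h" by (auto simp: linked_def)
  then have l': "mul k h l" using mul_cancel_left'[OF l] mul_carrier[OF k(2)] by simp
  have "E w l s'" using E_trans[OF k(1) assms(2) l'] .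
  moreover have "mul l r' p" using mul_assoc[OF l' assms(4)] k(2) by blast
  ultimately show ?thesis using w assms(3) unfolding up_def by blast
qed

lemma E'_tri_down_flat:
  assumes "up t q u" "up s r u" "up s r' v" "mul r y r'" "mul (pinv P q) z y"
  shows "up t z v"
proof -
  obtain h where h: "E s h t" "mul h q r" using up_up assms by blast
  have "mul h z r'" using mul_assoc[OF mul_cancel_right[OF h(2)] assms(5)] assms(4) by simp
  then show ?thesis using up_move[OF assms(3) h(1)] up_length[OF assms(1)] by simp
qed

lemma E'_tri:
  assumes ux: "E' u x t" and uy: "E' u y v" and xy: "mul x z y"
  shows "E' t z v"
proof -
  have carr: "x \<in> carrier P" "z \<in> carrier P" "y \<in> carrier P" using mul_carrier[OF xy] by auto
  have yz: "mul y (pinv P z) x" using mul_cancel_right[OF xy] .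
  have flip: "E' t z v" if "up v (pinv P z) t" using E'_down[OF that] pinv_pinv carr by simp
  have up_low: "up b c w" if ab: "E u a b" "up u e w" "mul a c e" for a b c e w
  proof -
    have free: "free u e" using up_free[OF ab(2)] .
    \<comment> \<open>A word shorter than \<open>n\<close> has all its edges in the ball, and then
      the direction \<open>e\<close> would not be free at \<open>u\<close>.\<close>
    have "length b = n"
    proof (rule ccontr)
      assume "length b \<noteq> n"
      then have "length b < n" using E_length ab(1) by fastforce
      then obtain b' where "E b c b'" using E_total[of b c] E_dom[OF ab(1)] mul_carrier[OF ab(3)] by blast
      then have "E u e b'" by (rule E_trans[OF ab(1) _ ab(3)])
      then show False using free by (auto simp: free_def)
    qed
    then show ?thesis by (rule up_move[OF ab(2,1) _ ab(3)])
  qed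
  from ux show ?thesis
  proof (cases rule: E'_cases)
    case ut: old
    from uy show ?thesis
    proof (cases rule: E'_cases)
      case old
      show ?thesis using E_tri[OF ut old xy] by (simp add: E'_def)
    next
      case up
      show ?thesis by (rule E'_up[OF up_low[OF ut up xy]])
    qed (use E_not_up[OF ut] in blast)+
  next
    case ut: up
    from uy show ?thesis
    proof (cases rule: E'_cases)
      case old
      show ?thesis by (rule flip[OF up_low[OF old ut yz]])
    next
      case up
      show ?thesis by (rule E'_flat[OF ut up xy])
    qed (use up_not_up[OF ut] in blast)+
  next
    case ut: (down r)
    from uy show ?thesis
    proof (cases rule: E'_cases)
      case (down q)
      obtain h where h: "E t h v" "mul h q r" using up_up[OF ut(1) down(1)] .
      have "mul r (pinv P q) z" using mul_cancel_left'[of r z "pinv P q"] xy ut down by simp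
      then have "h = z" by (rule mul_unique[OF mul_cancel_right[OF h(2)]])
      then show ?thesis using h by (simp add: E'_def)
    next
      case (flat s r1 r2)
      have "mul (pinv P r) z y" using xy ut(2) by simp
      then show ?thesis by (rule E'_up[OF E'_tri_down_flat[OF ut(1) flat]])
    qed (use E_not_up up_not_up ut(1) in blast)+
  next
    case ut: (flat s r1 r2)
    from uy show ?thesis
    proof (cases rule: E'_cases)
      case (down q)
      have "mul (pinv P q) (pinv P z) x" using yz down(2) by simp
      then show ?thesis by (rule flip[OF E'_tri_down_flat[OF down(1) ut]])
    next
      case uv: (flat s' q1 q2)
      have q1: "q1 \<in> carrier P" and r1: "r1 \<in> carrier P"
        using mul_carrier[OF uv(3)] mul_carrier[OF ut(3)] by auto
      obtain h where h: "E s h s'" "mul h q1 r1" using up_up[OF ut(1) uv(1)] .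
      \<comment> \<open>Seen from \<open>u\<close>, the vertices \<open>s, t, v, s'\<close> form a
        4-cycle. A chord puts \<open>s\<close> below \<open>v\<close> or \<open>s'\<close> below
        \<open>t\<close>; either way \<open>t\<close> and \<open>v\<close> obtain the common lower
        neighbour that a flat edge requires.\<close>
      have "linked (pinv P r1) x" "linked x y" "linked y (pinv P q1)" "linked (pinv P q1) (pinv P r1)"
        using mul_cancel_left[OF ut(3)] xy mul_cancel_left[OF uv(3)]
          mul_cancel_right[OF mul_cancel_left[OF mul_cancel_right[OF h(2)]]] linked_sym
        unfolding linked_def by blast+
      then have "linked (pinv P r1) y \<or> linked x (pinv P q1)" by (rule linked_cycle4[OF A4])
      then consider k where "mul (pinv P r1) k y" | k where "mul (pinv P q1) k x"
        using linked_sym unfolding linked_def by blast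
      then show ?thesis
      proof cases
        case 1
        have "mul r2 z k" using mul_assoc[OF ut(3) xy] mul_cancel_left'[OF 1 r1] by simp
        moreover have "up s k v" using E'_tri_down_flat[OF ut(1) uv 1] .
        ultimately show ?thesis using E'_flat[OF ut(2)] by blast
      next
        case 2
        have "mul k z q2" using mul_assoc[OF mul_cancel_left'[OF 2 q1] xy] uv(3) by simp
        moreover have "up s' k t" using E'_tri_down_flat[OF uv(1) ut 2] .
        ultimately show ?thesis using E'_flat[OF _ uv(2)] by blast
      qed
    qed (use E_not_up up_not_up ut(1) in blast)+
  qed
qed

lemma up_uniq:
  assumes "up s r v" "up s r' v"
  shows "r = r'"
proof -
  obtain h where h: "E s h s" "mul h r' r" using up_up[OF assms] .
  have s: "s \<in> S" using up_S[OF assms(1)] by simp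
  have "h = pone P" by (rule E_uniq[OF h(1) E_refl[OF s]])
  then show ?thesis using mul_unique[OF h(2)] mul_one_left[of r'] mul_carrier[OF h(2)] by simp
qed

lemma E'_uniq:
  assumes ux: "E' u x t" and uy: "E' u y t"
  shows "x = y"
  using ux
proof (cases rule: E'_cases)
  case ut: old
  from uy show ?thesis
  proof (cases rule: E'_cases)
    case old
    then show ?thesis by (rule E_uniq[OF ut])
  next
    case up
    then show ?thesis using E_not_up[OF E_sym[OF ut]] E_length[OF ut] up_length[of u y t] by simp
  qed (use E_not_up[OF ut] in blast)+
next
  case ut: up
  from uy show ?thesis
  proof (cases rule: E'_cases)
    case old
    then show ?thesis using E_length[of u y t] up_length[OF ut] by simp
  next
    case up
    then show ?thesis by (rule up_uniq[OF ut])
  qed (use up_not_up[OF ut] in blast)+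
next
  case ut: (down r)
  from uy show ?thesis
  proof (cases rule: E'_cases)
    case (down q)
    then show ?thesis using up_uniq[OF ut(1)] ut(2) by blast
  next
    case (flat s r1 r2)
    then show ?thesis using up_not_up[OF ut(1)] by blast
  qed (use E_not_up up_not_up ut(1) in blast)+
next
  case ut: (flat s r1 r2)
  from uy show ?thesis
  proof (cases rule: E'_cases)
    case (down q)
    then show ?thesis using up_not_up[OF down(1)] ut(2) by blast
  next
    case uv: (flat s' q1 q2)
    obtain h where h: "E s h s'" "mul h q1 r1" using up_up[OF ut(1) uv(1)] .
    obtain k where k: "E s k s'" "mul k q2 r2" using up_up[OF ut(2) uv(2)] .
    have "h = k" by (rule E_uniq[OF h(1) k(1)])
    then have "mul r1 y r2" using mul_assoc[OF h(2) uv(3)] k(2) by simp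
    then show ?thesis by (rule mul_left_unique[OF ut(3)])
  qed (use E_not_up up_not_up ut(1) in blast)+
qed

lemma S'_cases:
  assumes "u \<in> S'"
  obtains "u \<in> S" "length u \<le> n" | w p where "u = w @ [p]" "free w p" "length u = Suc n"
  using assms S_lists unfolding S'_def free_def by fastforce

lemma E'_down_linked:
  assumes "E' u x t" "E' u y v" "length t < length u" "length v < length u"
  shows "linked x y"
  using assms(1)
proof (cases rule: E'_cases)
  case ut: old
  from assms(2) show ?thesis
  proof (cases rule: E'_cases)
    case old
    then show ?thesis by (rule E_down[OF ut _ assms(3,4)])
  next
    case up
    then show ?thesis using up_length[OF up] assms(4) by simp
  qed (use E_not_up[OF ut] in blast)+
next
  case ut: up
  then show ?thesis using up_length[OF ut] assms(3) by simp
next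
  case ut: (down r)
  from assms(2) show ?thesis
  proof (cases rule: E'_cases)
    case (down q)
    obtain h where h: "E t h v" "mul h q r" using up_up[OF ut(1) down(1)] .
    show ?thesis
      using mul_cancel_left[OF mul_cancel_right[OF h(2)]] ut(2) down(2) by (auto simp: linked_def)
  next
    case (flat s r1 r2)
    then show ?thesis using up_length[OF flat(1)] up_length[OF flat(2)] assms(4) by simp
  qed (use E_not_up up_not_up ut(1) in blast)+
next
  case ut: (flat s r1 r2)
  then show ?thesis using up_length[OF ut(1)] up_length[OF ut(2)] assms(3) by simp
qed

lemma E'_flat_lower:
  assumes "E' u x t" "length t = length u" "u \<noteq> []"
  shows "\<exists>y v. E' u y v \<and> length v < length u \<and> linked y x"
  using assms(1)
proof (cases rule: E'_cases)
  case old
  then show ?thesis using E_flat[OF old assms(2,3)] unfolding E'_def by blast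
next
  case up
  then show ?thesis using up_length[OF up] assms(2) by linarith
next
  case (down r)
  then show ?thesis using up_length[OF down(1)] assms(2) by linarith
next
  case (flat s r r')
  have "linked (pinv P r) x" using mul_cancel_left[OF flat(3)] by (auto simp: linked_def)
  moreover have "length s < length u" using up_length[OF flat(1)] by simp
  ultimately show ?thesis using E'_down[OF flat(1)] by blast
qed

theorem ball_Suc: "ball P (Suc n) S' E'"
proof unfold_locales
  show "u \<in> S' \<and> x \<in> carrier P \<and> t \<in> S'" if "E' u x t" for u x t
    using that
  proof (cases rule: E'_cases)
    case old
    then show ?thesis using E_dom[OF old] by (simp add: S'_def)
  next
    case up
    then show ?thesis using up_S[OF up] by (simp add: S'_def)
  next
    case (down r)
    then show ?thesis using up_S[OF down(1)] pinv_carrier[of r] by (simp add: S'_def)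
  next
    case (flat s r r')
    then show ?thesis using up_S[OF flat(1)] up_S[OF flat(2)] mul_carrier[OF flat(3)] by simp
  qed
  show "u \<in> lists (carrier P) \<and> length u \<le> Suc n" if "u \<in> S'" for u
    using that
  proof (cases rule: S'_cases)
    case 1
    then show ?thesis using S_lists[of u] by simp
  next
    case (2 w p)
    then show ?thesis using S_lists[of w] by (simp add: free_def)
  qed
  show "[] \<in> S'" using Nil_S by (simp add: S'_def)
  show "E' u (pone P) u" if "u \<in> S'" for u
    using that
  proof (cases rule: S'_cases)
    case 1
    then show ?thesis using E_refl by (simp add: E'_def)
  next
    case (2 w p)
    have "p \<in> carrier P" using 2 by (simp add: free_def)
    then show ?thesis using E'_flat[OF up_refl up_refl mul_one_right] 2 by simp
  qed
  show "E' t z v" if "E' u x t" "E' u y v" "mul x z y" for u x t y v z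
    using E'_tri that .
  show "x = y" if "E' u x t" "E' u y t" for u x y t
    using E'_uniq that .
  show "length t \<le> Suc (length u)" if "E' u x t" for u x t
    using that
  proof (cases rule: E'_cases)
    case old
    then show ?thesis by (rule E_level)
  next
    case up
    then show ?thesis using up_length[OF up] by simp
  next
    case (down r)
    then show ?thesis using up_length[OF down(1)] by simp
  next
    case (flat s r r')
    then show ?thesis using up_length[OF flat(1)] up_length[OF flat(2)] by simp
  qed
  show "length t = length u" if "E' u (pone P) t" for u t
  proof -
    \<comment> \<open>The direction \<open>pone P\<close> is never free, because of the loop at
      \<open>s\<close>.\<close>
    have no: False if "up s (pone P) v" for s v
      using up_free[OF that] E_refl unfolding free_def by blast
    from that show ?thesis
    proof (cases rule: E'_cases)
      case old
      then show ?thesis by (rule E_one)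
    next
      case up
      then show ?thesis using no by blast
    next
      case (down r)
      then have "r = pone P" using pinv_pinv[of r] pinv_one by simp
      then show ?thesis using no down(1) by blast
    next
      case (flat s r r')
      then show ?thesis using up_length[OF flat(1)] up_length[OF flat(2)] by simp
    qed
  qed
  show "\<exists>t. E' u x t" if "u \<in> S'" "length u < Suc n" "x \<in> carrier P" for u x
  proof -
    have u: "u \<in> S" using that(1,2) by (cases rule: S'_cases) simp_all
    \<comment> \<open>On the old sphere a direction without an edge is free, and then it ends at the
      new word \<open>u @ [x]\<close>.\<close>
    have "(\<exists>t. E u x t) \<or> length u < n \<or> free u x"
      using u that(2,3) unfolding free_def by (simp add: less_Suc_eq) blast
    then consider t where "E u x t" | "length u < n" | "free u x" by blast
    then show ?thesis
    proof cases
      case 1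
      then show ?thesis unfolding E'_def by blast
    next
      case 2
      then show ?thesis using E_total[OF u 2 that(3)] unfolding E'_def by blast
    next
      case 3
      then show ?thesis using E'_up[OF up_refl[OF 3]] by blast
    qed
  qed
  show "linked x y" if "E' u x t" "E' u y v" "length t < length u" "length v < length u" for u x t y v
    using E'_down_linked that .
  show "\<exists>y v. E' u y v \<and> length v < length u \<and> linked y x"
    if "E' u x t" "length t = length u" "u \<noteq> []" for u x t
    using E'_flat_lower that .
  show "E' w p (w @ [p])" if "w @ [p] \<in> S'" for w p
    using that
  proof (cases rule: S'_cases)
    case 1
    then show ?thesis using S_prefix by (simp add: E'_def)
  next
    case (2 w' p')
    then show ?thesis using E'_up[OF up_refl] by simp
  qed
qed

end

section \<open>The union of all balls\<close>

locale pree46 = pree +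
  assumes axiom_A4: "axiom_A P 4" and axiom_A5: "axiom_A P 5"
begin

primrec balls :: "nat \<Rightarrow> 'a list set \<times> ('a list \<Rightarrow> 'a \<Rightarrow> 'a list \<Rightarrow> bool)" where
  "balls 0 = ({[]}, \<lambda>u x t. u = [] \<and> x = pone P \<and> t = [])"
| "balls (Suc n) = (ball.S' P n (fst (balls n)) (snd (balls n)),
     ball.E' P n (fst (balls n)) (snd (balls n)))"

lemma ball_balls: "ball P n (fst (balls n)) (snd (balls n))"
proof (induction n)
  case 0
  have "z = pone P" if "mul (pone P) z (pone P)" for z
    using mul_left_unique[OF that mul_one_left[OF one_closed]] .
  then show ?case by unfold_locales (auto simp: one_closed linked_refl)
next
  case (Suc n)
  interpret ball P n "fst (balls n)" "snd (balls n)" by (rule Suc)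
  interpret ball46 P n "fst (balls n)" "snd (balls n)"
    by unfold_locales (rule axiom_A4 axiom_A5)+
  show ?case using ball_Suc by simp
qed

definition vertices :: "'a list set" where
  "vertices = (\<Union>n. fst (balls n))"

definition edge :: "'a list \<Rightarrow> 'a \<Rightarrow> 'a list \<Rightarrow> bool" where
  "edge u x t \<longleftrightarrow> (\<exists>n. snd (balls n) u x t)"

lemma balls_Suc: "fst (balls n) \<subseteq> fst (balls (Suc n))"
  "snd (balls n) u x t \<Longrightarrow> snd (balls (Suc n)) u x t"
proof -
  interpret ball P n "fst (balls n)" "snd (balls n)" by (rule ball_balls)
  show "fst (balls n) \<subseteq> fst (balls (Suc n))" by (simp add: S'_def)
  show "snd (balls (Suc n)) u x t" if "snd (balls n) u x t" using that by (simp add: E'_def)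
qed

lemma balls_mono:
  assumes "m \<le> n"
  shows "fst (balls m) \<subseteq> fst (balls n)" "snd (balls m) u x t \<Longrightarrow> snd (balls n) u x t"
proof -
  show "fst (balls m) \<subseteq> fst (balls n)"
    using assms by (rule lift_Suc_mono_le[of "\<lambda>n. fst (balls n)", rotated]) (rule balls_Suc)
  show "snd (balls m) u x t \<Longrightarrow> snd (balls n) u x t"
    using assms by (induction n rule: dec_induct) (use balls_Suc(2) in blast)+
qed

lemma edge_obtain2:
  assumes "edge u x t" "edge u' y v"
  obtains n where "snd (balls n) u x t" "snd (balls n) u' y v"
proof -
  obtain k l where "snd (balls k) u x t" "snd (balls l) u' y v" using assms by (auto simp: edge_def)
  then have "snd (balls (max k l)) u x t" "snd (balls (max k l)) u' y v"
    using balls_mono(2) max.cobounded1 max.cobounded2 by blast+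
  then show thesis using that by blast
qed

lemma edge_dom: "edge u x t \<Longrightarrow> u \<in> vertices \<and> x \<in> carrier P \<and> t \<in> vertices"
  unfolding edge_def vertices_def using ball.E_dom[OF ball_balls] by blast

lemma vertices_lists: "u \<in> vertices \<Longrightarrow> u \<in> lists (carrier P)"
  unfolding vertices_def using ball.S_lists[OF ball_balls] by blast

lemma Nil_vertices: "[] \<in> vertices"
  unfolding vertices_def using ball.Nil_S[OF ball_balls] by blast

lemma edge_refl: "u \<in> vertices \<Longrightarrow> edge u (pone P) u"
  unfolding edge_def vertices_def using ball.E_refl[OF ball_balls] by blast

lemma edge_tri: "edge u x t \<Longrightarrow> edge u y v \<Longrightarrow> mul x z y \<Longrightarrow> edge t z v"
  by (erule (1) edge_obtain2) (auto simp: edge_def dest: ball.E_tri[OF ball_balls])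

lemma edge_uniq: "edge u x t \<Longrightarrow> edge u y t \<Longrightarrow> x = y"
  by (erule (1) edge_obtain2) (rule ball.E_uniq[OF ball_balls])

lemma edge_level: "edge u x t \<Longrightarrow> length t \<le> Suc (length u)"
  unfolding edge_def using ball.E_level[OF ball_balls] by blast

lemma edge_one: "edge u (pone P) t \<Longrightarrow> length t = length u"
  unfolding edge_def using ball.E_one[OF ball_balls] by blast

lemma edge_total:
  assumes "u \<in> vertices" "x \<in> carrier P"
  shows "\<exists>t. edge u x t"
proof -
  obtain k where "u \<in> fst (balls k)" using assms by (auto simp: vertices_def)
  \<comment> \<open>A ball has all edges only at words strictly shorter than its radius, hence the
    successor.\<close>
  then have "u \<in> fst (balls (max k (Suc (length u))))" using balls_mono(1)[OF max.cobounded1] by blast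
  then show ?thesis using ball.E_total[OF ball_balls _ _ assms(2)] unfolding edge_def by force
qed

lemma edge_down:
  "edge u x t \<Longrightarrow> edge u y v \<Longrightarrow> length t < length u \<Longrightarrow> length v < length u \<Longrightarrow> linked x y"
  by (erule (1) edge_obtain2) (rule ball.E_down[OF ball_balls])

lemma edge_flat:
  "edge u x t \<Longrightarrow> length t = length u \<Longrightarrow> u \<noteq> [] \<Longrightarrow>
    \<exists>y v. edge u y v \<and> length v < length u \<and> linked y x"
  unfolding edge_def using ball.E_flat[OF ball_balls] by blast

lemma vertices_prefix: "w @ [p] \<in> vertices \<Longrightarrow> edge w p (w @ [p])"
  unfolding edge_def vertices_def using ball.S_prefix[OF ball_balls] by blast

lemma edge_sym: "edge u x t \<Longrightarrow> edge t (pinv P x) u"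
  using edge_tri[OF _ edge_refl mul_pinv(1)] edge_dom by blast

lemma edge_trans: "edge u x t \<Longrightarrow> edge t z v \<Longrightarrow> mul x z y \<Longrightarrow> edge u y v"
  by (rule edge_tri[OF edge_sym _ mul_cancel_left])

end

section \<open>Identification with the universal group\<close>

context pree46
begin

abbreviation relators :: "'a letter list set" where
  "relators \<equiv> {[(a, True), (b, True), (c, False)] | a b c.
     a \<in> carrier P \<and> b \<in> carrier P \<and> pmult P a b = Some c}"

abbreviation U :: "'a letter list set monoid" where
  "U \<equiv> universal_group P"

abbreviation cls :: "'a letter list \<Rightarrow> 'a letter list set" where
  "cls w \<equiv> pres_rel (carrier P) relators `` {w}"

definition gen :: "'a \<Rightarrow> 'a letter list set" where
  "gen a = cls [(a, True)]"

sublocale U: group U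
  by (rule group_universal_group)

lemma cls_mult:
  "v \<in> group_words (carrier P) \<Longrightarrow> w \<in> group_words (carrier P) \<Longrightarrow> cls v \<otimes>\<^bsub>U\<^esub> cls w = cls (v @ w)"
  unfolding universal_group_def by (rule presented_group_mult)

lemma cls_one: "cls [] = \<one>\<^bsub>U\<^esub>"
  by (simp add: universal_group_def presented_group_def)

lemma cls_closed: "w \<in> group_words (carrier P) \<Longrightarrow> cls w \<in> carrier U"
  by (simp add: universal_group_def presented_group_def quotientI)

lemma carrier_U: "carrier U = cls ` group_words (carrier P)"
  by (auto simp: universal_group_def presented_group_def quotient_def)

lemma cls_eq_iff:
  assumes "v \<in> group_words (carrier P)" "w \<in> group_words (carrier P)"
  shows "cls v = cls w \<longleftrightarrow> (v, w) \<in> pres_rel (carrier P) relators"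
  using eq_equiv_class_iff[OF equiv_pres_rel assms] .

lemma gen_closed: "a \<in> carrier P \<Longrightarrow> gen a \<in> carrier U"
  unfolding gen_def by (rule cls_closed) simp

lemma cls_cancel:
  assumes "a \<in> carrier P"
  shows "cls [(a, b)] \<otimes>\<^bsub>U\<^esub> cls [(a, \<not> b)] = \<one>\<^bsub>U\<^esub>"
proof -
  have "([(a, b), (a, \<not> b)], []) \<in> pres_rel (carrier P) relators"
    using pres_rel.cancel[of "[]" "carrier P" "[]" "(a, b)" relators] assms
    by (simp add: inv_letter_def)
  then have "cls [(a, b), (a, \<not> b)] = cls []" using assms by (subst cls_eq_iff) auto
  then show ?thesis using assms cls_mult[of "[(a, b)]" "[(a, \<not> b)]"] cls_one by simp
qed

lemma cls_False: "a \<in> carrier P \<Longrightarrow> cls [(a, False)] = inv\<^bsub>U\<^esub> gen a"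
  using cls_cancel[of a False] U.inv_equality[of "cls [(a, False)]" "gen a"] cls_closed
    gen_closed by (simp add: gen_def)

lemma gen_mult:
  assumes "mul a b c"
  shows "gen a \<otimes>\<^bsub>U\<^esub> gen b = gen c"
proof -
  have carr: "a \<in> carrier P" "b \<in> carrier P" "c \<in> carrier P" using mul_carrier[OF assms] by auto
  have "([(a, True), (b, True), (c, False)], []) \<in> pres_rel (carrier P) relators"
    using pres_rel.relator[of "[]" "carrier P" "[]" "[(a, True), (b, True), (c, False)]" relators]
      carr assms by (auto simp: mul_def)
  then have "cls [(a, True), (b, True), (c, False)] = \<one>\<^bsub>U\<^esub>"
    using carr by (subst cls_one[symmetric], subst cls_eq_iff) auto
  moreover have "cls [(a, True), (b, True), (c, False)] = gen a \<otimes>\<^bsub>U\<^esub> gen b \<otimes>\<^bsub>U\<^esub> inv\<^bsub>U\<^esub> gen c"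
    unfolding cls_False[OF carr(3), symmetric] unfolding gen_def using carr by (simp add: cls_mult)
  ultimately show ?thesis
    using carr gen_closed U.inv_equality[of "gen a \<otimes>\<^bsub>U\<^esub> gen b" "inv\<^bsub>U\<^esub> gen c"] by simp
qed

lemma gen_one: "gen (pone P) = \<one>\<^bsub>U\<^esub>"
  using gen_mult[OF mul_one_left[OF one_closed]] gen_closed[OF one_closed] U.l_cancel_one by simp

lemma gen_pinv: "a \<in> carrier P \<Longrightarrow> gen (pinv P a) = inv\<^bsub>U\<^esub> gen a"
  using gen_mult[OF mul_pinv(2)[of a]] gen_one gen_closed pinv_carrier
    U.inv_equality[of "gen (pinv P a)" "gen a"] by simp

definition val :: "'a list \<Rightarrow> 'a letter list set" where
  "val u = cls (map (\<lambda>a. (a, True)) u)"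

lemma map_True_words: "u \<in> lists (carrier P) \<Longrightarrow> map (\<lambda>a. (a, True)) u \<in> group_words (carrier P)"
  by (induction u) auto

lemma val_Nil: "val [] = \<one>\<^bsub>U\<^esub>"
  by (simp add: val_def cls_one)

lemma val_snoc: "u \<in> lists (carrier P) \<Longrightarrow> p \<in> carrier P \<Longrightarrow> val (u @ [p]) = val u \<otimes>\<^bsub>U\<^esub> gen p"
  using cls_mult[of "map (\<lambda>a. (a, True)) u" "[(p, True)]"] map_True_words[of u]
  by (simp add: val_def gen_def)

lemma val_closed: "u \<in> vertices \<Longrightarrow> val u \<in> carrier U"
  unfolding val_def by (rule cls_closed[OF map_True_words[OF vertices_lists]])

text \<open>By construction \<open>val\<close> respects only the edges that append a letter. If an
  edge ascends from \<open>u\<close> to \<open>t = w @ [p]\<close>, then \<open>u\<close> and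
  \<open>w\<close> both lie below \<open>t\<close>, hence are adjacent, and the edge between them
  has smaller total length. A descending edge is the inverse of an ascending one, and a flat edge
  splits at a common lower neighbour.\<close>

lemma edge_val: "edge u x t \<Longrightarrow> val u \<otimes>\<^bsub>U\<^esub> gen x = val t"
proof (induction "length u + length t" arbitrary: u x t rule: less_induct)
  case less
  note e = less.prems
  have dom: "u \<in> vertices" "x \<in> carrier P" "t \<in> vertices" using edge_dom[OF e] by auto
  have up: "val u \<otimes>\<^bsub>U\<^esub> gen x = val t" if e: "edge u x t" and l: "length t = Suc (length u)"
    and IH: "\<And>u' x' t'. length u' + length t' < length u + length t \<Longrightarrow> edge u' x' t' \<Longrightarrow>
      val u' \<otimes>\<^bsub>U\<^esub> gen x' = val t'" for u x t
  proof -
    obtain w p where t: "t = w @ [p]" using l by (cases t rule: rev_cases) auto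
    have dom: "u \<in> vertices" "x \<in> carrier P" "t \<in> vertices" using edge_dom[OF e] by auto
    have w: "edge w p t" using vertices_prefix dom t by simp
    have wdom: "w \<in> vertices" "p \<in> carrier P" using edge_dom[OF w] by auto
    have "linked (pinv P p) (pinv P x)"
      using edge_down[OF edge_sym[OF w] edge_sym[OF e]] t l by simp
    then obtain h where "mul (pinv P p) h (pinv P x)" by (auto simp: linked_def)
    then have h: "mul (pinv P p) h (pinv P x)" .
    have "mul (pinv P (pinv P h)) (pinv P (pinv P x)) (pinv P (pinv P p))"
      by (rule mul_inverse[OF mul_cancel_right[OF h]])
    then have hx: "mul h x p" using pinv_pinv mul_carrier[OF h] dom wdom by simp
    have "edge w h u" by (rule edge_tri[OF edge_sym[OF w] edge_sym[OF e] h])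
    then have "val w \<otimes>\<^bsub>U\<^esub> gen h = val u" using IH[of w u h] t l by simp
    moreover have "val t = val w \<otimes>\<^bsub>U\<^esub> (gen h \<otimes>\<^bsub>U\<^esub> gen x)"
      using val_snoc[OF vertices_lists] wdom t gen_mult[OF hx] by simp
    ultimately show ?thesis
      using val_closed[OF wdom(1)] gen_closed mul_carrier[OF hx] U.m_assoc by metis
  qed
  consider "length t = Suc (length u)" | "length u = Suc (length t)" | "length t = length u"
    using edge_level[OF e] edge_level[OF edge_sym[OF e]] by linarith
  then show ?case
  proof cases
    case 1
    then show ?thesis using up[OF e] less.hyps by blast
  next
    case 2
    have "val t \<otimes>\<^bsub>U\<^esub> gen (pinv P x) = val u"
      by (rule up[OF edge_sym[OF e] 2], rule less.hyps) auto
    then show ?thesis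
      using U.inv_solve_right[of "val u" "val t" "gen x"] gen_pinv dom gen_closed val_closed by simp
  next
    case 3
    show ?thesis
    proof (cases "u = []")
      case True
      then have "t = []" using 3 by simp
      then have "x = pone P" using edge_uniq[OF e] edge_refl dom True by blast
      then show ?thesis using \<open>t = []\<close> True by (simp add: val_Nil gen_one)
    next
      case False
      obtain y v z where y: "edge u y v" "length v < length u" "mul y z x"
        using edge_flat[OF e 3 False] by (auto simp: linked_def)
      have "edge v z t" by (rule edge_tri[OF y(1) e y(3)])
      then have "val u \<otimes>\<^bsub>U\<^esub> gen y = val v" "val v \<otimes>\<^bsub>U\<^esub> gen z = val t"
        using less.hyps y 3 by simp_all
      then show ?thesis
        using gen_mult[OF y(3)] val_closed[OF dom(1)] gen_closed mul_carrier[OF y(3)] U.m_assoc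
        by metis
    qed
  qed
qed

section \<open>The action of words on the points of the graph\<close>

definition point :: "'a list \<Rightarrow> 'a list set" where
  "point u = {v. edge u (pone P) v}"

definition act :: "'a list set \<Rightarrow> 'a \<Rightarrow> 'a list set" where
  "act X p = {v. \<exists>u\<in>X. edge u p v}"

definition letter_value :: "'a letter \<Rightarrow> 'a" where
  "letter_value l = (if snd l then fst l else pinv P (fst l))"

definition word_act :: "'a list set \<Rightarrow> 'a letter list \<Rightarrow> 'a list set" where
  "word_act = foldl (\<lambda>X l. act X (letter_value l))"

lemma act_point:
  assumes "edge u p v"
  shows "act (point u) p = point v"
proof -
  have dom: "u \<in> vertices" "p \<in> carrier P" using edge_dom[OF assms] by auto
  have "edge v (pone P) v'" if "edge u (pone P) u'" "edge u' p v'" for u' v'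
    using edge_tri[OF assms edge_trans[OF that mul_one_left] mul_one_right] dom by blast
  moreover have "edge u p v'" if "edge v (pone P) v'" for v'
    using edge_trans[OF assms that mul_one_right] dom by blast
  ultimately show ?thesis using edge_refl dom unfolding act_def point_def by blast
qed

lemma letter_value_carrier: "l \<in> carrier P \<times> UNIV \<Longrightarrow> letter_value l \<in> carrier P"
  using pinv_carrier by (auto simp: letter_value_def)

lemma act_exists:
  assumes "X \<in> point ` vertices" "p \<in> carrier P"
  obtains u v where "edge u p v" "X = point u" "act X p = point v"
proof -
  obtain u where u: "u \<in> vertices" "X = point u" using assms by blast
  obtain v where "edge u p v" using edge_total[OF u(1) assms(2)] by blast
  then show thesis using that u act_point by blast
qed

lemma act_point_closed:
  assumes "X \<in> point ` vertices" "p \<in> carrier P"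
  shows "act X p \<in> point ` vertices"
  using act_exists[OF assms] edge_dom by (metis imageI)

lemma act_mult:
  assumes "X \<in> point ` vertices" "mul a b c"
  shows "act (act X a) b = act X c"
proof -
  have carr: "a \<in> carrier P" "b \<in> carrier P" using mul_carrier[OF assms(2)] by auto
  obtain u v where v: "edge u a v" "X = point u" "act X a = point v"
    using act_exists[OF assms(1) carr(1)] .
  obtain w where w: "edge v b w" using edge_total carr edge_dom[OF v(1)] by blast
  show ?thesis using v act_point[OF w] act_point[OF edge_trans[OF v(1) w assms(2)]] by simp
qed

lemma act_one: "X \<in> point ` vertices \<Longrightarrow> act X (pone P) = X"
  using act_point[OF edge_refl] by blast

lemma word_act_append: "word_act X (v @ w) = word_act (word_act X v) w"
  by (simp add: word_act_def)

lemma word_act_Cons: "word_act X (l # w) = word_act (act X (letter_value l)) w"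
  by (simp add: word_act_def)

lemma word_act_Nil: "word_act X [] = X"
  by (simp add: word_act_def)

lemma word_act_closed:
  "w \<in> group_words (carrier P) \<Longrightarrow> X \<in> point ` vertices \<Longrightarrow> word_act X w \<in> point ` vertices"
proof (induction w arbitrary: X)
  case (Cons l w)
  then have "act X (letter_value l) \<in> point ` vertices"
    using act_point_closed letter_value_carrier by simp
  then show ?case using Cons by (simp add: word_act_Cons)
qed (simp add: word_act_Nil)

text \<open>Relators act trivially because a defined product closes a triangle of the graph. Thus
  words that move a point differently are distinct in \<open>U\<close>; this is the counterpart of
  \<open>edge_val\<close>, which yields equalities in \<open>U\<close>.\<close>

lemma word_act_pres_rel:
  "(v, w) \<in> pres_rel (carrier P) relators \<Longrightarrow> X \<in> point ` vertices \<Longrightarrow> word_act X v = word_act X w"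
proof (induction rule: pres_rel.induct)
  case (cancel u v l)
  let ?Y = "word_act X u"
  have Y: "?Y \<in> point ` vertices" using word_act_closed cancel by blast
  have "mul (letter_value l) (letter_value (inv_letter l)) (pone P)"
    using cancel.hyps(3) mul_pinv by (auto simp: letter_value_def inv_letter_def)
  then show ?case by (simp add: word_act_append word_act_Cons word_act_Nil act_mult[OF Y] act_one[OF Y])
next
  case (relator u v r)
  let ?Y = "word_act X u"
  have Y: "?Y \<in> point ` vertices" using word_act_closed relator by blast
  obtain a b c where r: "r = [(a, True), (b, True), (c, False)]" "mul a b c"
    using relator.hyps(3) by (auto simp: mul_def)
  have c: "c \<in> carrier P" using mul_carrier[OF r(2)] by simp
  have "act (act (act ?Y a) b) (pinv P c) = ?Y"
    using act_mult[OF Y r(2)] act_mult[OF Y mul_pinv(1)[OF c]] act_one[OF Y] by simp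
  then show ?case using r(1) by (simp add: word_act_append word_act_Cons word_act_Nil letter_value_def)
qed simp_all

lemma word_act_vertex:
  "u \<in> vertices \<Longrightarrow> word_act (point []) (map (\<lambda>a. (a, True)) u) = point u"
proof (induction u rule: rev_induct)
  case (snoc p w)
  have e: "edge w p (w @ [p])" using vertices_prefix[OF snoc.prems] .
  then show ?case
    using snoc.IH edge_dom[OF e] act_point[OF e]
    by (simp add: word_act_append word_act_Cons word_act_Nil letter_value_def)
qed (simp add: word_act_Nil)

text \<open>The word \<open>u\<close> moves the base point to \<open>point u\<close>, so its class
  in \<open>U\<close> determines the vertex.\<close>

lemma val_inj:
  assumes "u \<in> vertices" "v \<in> vertices" "val u = val v"
  shows "edge u (pone P) v"
proof -
  have "(map (\<lambda>a. (a, True)) u, map (\<lambda>a. (a, True)) v) \<in> pres_rel (carrier P) relators"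
    using assms(3) cls_eq_iff[OF map_True_words map_True_words] assms(1,2) vertices_lists
    unfolding val_def by blast
  then have "point u = point v"
    using word_act_pres_rel[of _ _ "point []"] word_act_vertex assms(1,2) Nil_vertices by fastforce
  then show ?thesis using edge_refl[OF assms(2)] by (auto simp: point_def)
qed

lemma val_surj: "g \<in> carrier U \<Longrightarrow> \<exists>u\<in>vertices. val u = g"
proof -
  have "\<exists>u\<in>vertices. val u = cls w" if "w \<in> group_words (carrier P)" for w
    using that
  proof (induction w rule: rev_induct)
    case Nil
    then show ?case using Nil_vertices val_Nil cls_one by auto
  next
    case (snoc l w)
    have l: "letter_value l \<in> carrier P" "fst l \<in> carrier P"
      using snoc.prems letter_value_carrier by auto
    obtain u where u: "u \<in> vertices" "val u = cls w" using snoc by auto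
    obtain t where t: "edge u (letter_value l) t" using edge_total[OF u(1) l(1)] by blast
    have "gen (letter_value l) = cls [l]"
      using l(2) cls_False[of "fst l"] gen_pinv[of "fst l"]
      by (cases l) (auto simp: letter_value_def gen_def)
    then have "val t = cls (w @ [l])"
      using edge_val[OF t] u cls_mult[of w "[l]"] snoc.prems by simp
    then show ?case using edge_dom[OF t] by blast
  qed
  then show "g \<in> carrier U \<Longrightarrow> \<exists>u\<in>vertices. val u = g" unfolding carrier_U by blast
qed

section \<open>Word length, and the products of \<open>P\<close> inside the group\<close>

definition len :: "'a letter list set \<Rightarrow> nat" where
  "len g = length (SOME u. u \<in> vertices \<and> val u = g)"

text \<open>Words of equal value are joined by an edge labelled \<open>pone P\<close>, which
  preserves length, so the choice made in \<open>len\<close> is harmless.\<close>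

lemma len_val:
  assumes "u \<in> vertices"
  shows "len (val u) = length u"
proof -
  define v where "v = (SOME v. v \<in> vertices \<and> val v = val u)"
  have "v \<in> vertices \<and> val v = val u" unfolding v_def by (rule someI) (use assms in simp)
  then have "edge u (pone P) v" using val_inj assms by simp
  then have "length v = length u" by (rule edge_one)
  then show ?thesis by (simp add: len_def v_def)
qed

lemma len_edge:
  assumes "g \<in> carrier U"
  obtains u where "u \<in> vertices" "val u = g" "len g = length u"
    "\<And>x. x \<in> carrier P \<Longrightarrow> \<exists>t. edge u x t \<and> val t = g \<otimes>\<^bsub>U\<^esub> gen x \<and> len (g \<otimes>\<^bsub>U\<^esub> gen x) = length t"
proof -
  obtain u where u: "u \<in> vertices" "val u = g" using val_surj[OF assms] by blast
  have "\<exists>t. edge u x t \<and> val t = g \<otimes>\<^bsub>U\<^esub> gen x \<and> len (g \<otimes>\<^bsub>U\<^esub> gen x) = length t"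
    if x: "x \<in> carrier P" for x
  proof -
    obtain t where t: "edge u x t" using edge_total[OF u(1) x] by blast
    then show ?thesis using edge_val[OF t] u(2) len_val[of t] edge_dom[OF t] by metis
  qed
  then show thesis using that u len_val[OF u(1)] by metis
qed

lemma edge_val_target:
  assumes "edge u x t" "edge v y w" "val t = val w"
  shows "edge u x w"
proof -
  have "edge t (pone P) w" using val_inj assms edge_dom[OF assms(1)] edge_dom[OF assms(2)] by blast
  then show ?thesis using edge_trans[OF assms(1) _ mul_one_right] edge_dom[OF assms(1)] by blast
qed

text \<open>The triangle \<open>[], u, v\<close> with sides \<open>a\<close>, \<open>b\<close>,
  \<open>c\<close> lies in the ball of radius 1. If neither \<open>u\<close> nor \<open>v\<close> is
  the centre, the common lower neighbour of the flat edge can only be \<open>[]\<close>, so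
  \<open>pinv P a\<close> and \<open>b\<close> are linked, which is the missing product in
  \<open>P\<close>. In particular \<open>P\<close> embeds in \<open>U\<close> and acquires no new
  products.\<close>

lemma gen_mult_iff:
  assumes "a \<in> carrier P" "b \<in> carrier P" "c \<in> carrier P"
  shows "gen a \<otimes>\<^bsub>U\<^esub> gen b = gen c \<longleftrightarrow> mul a b c"
proof
  assume eq: "gen a \<otimes>\<^bsub>U\<^esub> gen b = gen c"
  obtain u where u: "edge [] a u" using edge_total[OF Nil_vertices assms(1)] by blast
  obtain v where v: "edge u b v" using edge_total edge_dom[OF u] assms(2) by blast
  obtain w where w: "edge [] c w" using edge_total[OF Nil_vertices assms(3)] by blast
  have "val v = val w"
    using edge_val[OF u] edge_val[OF v] edge_val[OF w] eq gen_closed assms by (simp add: val_Nil)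
  then have cv: "edge [] c v" using edge_val_target[OF w v] by simp
  have "length u \<le> 1" "length v \<le> 1" using edge_level[OF u] edge_level[OF cv] by simp_all
  then consider "u = []" | "v = []" | "length u = 1" "length v = 1"
    by (metis One_nat_def le_SucE le_zero_eq length_0_conv)
  then show "mul a b c"
  proof cases
    case 1
    then have "a = pone P" using edge_uniq u edge_refl[OF Nil_vertices] by blast
    moreover have "b = c" using edge_uniq v cv 1 by blast
    ultimately show ?thesis using mul_one_left assms by simp
  next
    case 2
    then have "c = pone P" using edge_uniq cv edge_refl[OF Nil_vertices] by blast
    moreover have "b = pinv P a" using edge_uniq[OF _ edge_sym[OF u]] v 2 by blast
    ultimately show ?thesis using mul_pinv assms by simp
  next
    case 3
    obtain y t where y: "edge u y t" "length t < length u" "linked y b"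
      using edge_flat[OF v] 3 by fastforce
    then have "t = []" using 3 by simp
    then have "y = pinv P a" using edge_uniq[OF _ edge_sym[OF u]] y by blast
    then obtain k where k: "mul (pinv P a) k b" using y by (auto simp: linked_def)
    have "edge [] k v" using edge_tri[OF edge_sym[OF u] v k] .
    then have "k = c" using edge_uniq cv by blast
    then show ?thesis using mul_cancel_left'[OF k assms(1)] by simp
  qed
qed (rule gen_mult)

lemma gen_linked:
  assumes "a \<in> carrier P" "b \<in> carrier P"
  shows "inv\<^bsub>U\<^esub> gen a \<otimes>\<^bsub>U\<^esub> gen b \<in> gen ` carrier P \<longleftrightarrow> linked a b"
proof -
  have "inv\<^bsub>U\<^esub> gen a \<otimes>\<^bsub>U\<^esub> gen b = gen c \<longleftrightarrow> mul a c b" if "c \<in> carrier P" for c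
    using gen_mult_iff[OF assms(1) that assms(2)] gen_closed assms that U.inv_solve_left' by metis
  then show ?thesis unfolding linked_def using mul_carrier by blast
qed

end

section \<open>Bridged graphs\<close>

text \<open>Adjacency includes equality, so a clique is a set with all pairs adjacent, and
  degenerate cycles in \<open>link4\<close> and \<open>link5\<close> have their chords
  trivially.\<close>

locale bridged =
  fixes V :: "'v set" and adj :: "'v \<Rightarrow> 'v \<Rightarrow> bool" and d :: "'v \<Rightarrow> 'v \<Rightarrow> nat"
  assumes adj_V: "adj x y \<Longrightarrow> x \<in> V \<and> y \<in> V"
    and adj_refl: "x \<in> V \<Longrightarrow> adj x x"
    and adj_sym: "adj x y \<Longrightarrow> adj y x"
    and finite_nbrs: "finite {y. adj x y}"
    and d_sym: "x \<in> V \<Longrightarrow> y \<in> V \<Longrightarrow> d x y = d y x"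
    and d_triangle: "x \<in> V \<Longrightarrow> y \<in> V \<Longrightarrow> z \<in> V \<Longrightarrow> d x z \<le> d x y + d y z"
    and d_zero: "x \<in> V \<Longrightarrow> y \<in> V \<Longrightarrow> d x y = 0 \<longleftrightarrow> x = y"
    and d_adj: "x \<in> V \<Longrightarrow> y \<in> V \<Longrightarrow> d x y \<le> 1 \<longleftrightarrow> adj x y"
    and ex_lower: "x \<in> V \<Longrightarrow> u \<in> V \<Longrightarrow> d u x = Suc m \<Longrightarrow> \<exists>y. adj x y \<and> d u y = m"
    and lower_clique: "\<lbrakk>u \<in> V; adj x y; adj x z; d u x = Suc m; d u y = m; d u z = m\<rbrakk> \<Longrightarrow> adj y z"
    and triangle_cond: "\<lbrakk>u \<in> V; adj x y; d u x = Suc m; d u y = Suc m\<rbrakk>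
      \<Longrightarrow> \<exists>z. adj x z \<and> adj y z \<and> d u z = m"
    and link4: "\<lbrakk>adj c x1; adj c x2; adj c x3; adj c x4; adj x1 x2; adj x2 x3; adj x3 x4; adj x4 x1\<rbrakk>
      \<Longrightarrow> adj x1 x3 \<or> adj x2 x4"
    and link5: "\<lbrakk>adj c x1; adj c x2; adj c x3; adj c x4; adj c x5;
        adj x1 x2; adj x2 x3; adj x3 x4; adj x4 x5; adj x5 x1\<rbrakk>
      \<Longrightarrow> adj x1 x3 \<or> adj x2 x4 \<or> adj x3 x5 \<or> adj x4 x1 \<or> adj x5 x2"
begin

lemma d_step: "adj x y \<Longrightarrow> u \<in> V \<Longrightarrow> d u y \<le> Suc (d u x)"
  using d_triangle[of u x y] d_adj[of x y] adj_V[of x y] by force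

lemma d_base_step: "adj u v \<Longrightarrow> x \<in> V \<Longrightarrow> d v x \<le> Suc (d u x)"
  using d_step[of u v x] d_sym adj_V by metis

section \<open>Projection of cliques to the next smaller sphere\<close>

definition proj :: "'v \<Rightarrow> 'v set \<Rightarrow> 'v set" where
  "proj u \<sigma> = {z. \<forall>x\<in>\<sigma>. adj x z \<and> Suc (d u z) = d u x}"

definition sphere_clique :: "'v \<Rightarrow> nat \<Rightarrow> 'v set \<Rightarrow> bool" where
  "sphere_clique u m \<sigma> \<longleftrightarrow> u \<in> V \<and> \<sigma> \<noteq> {} \<and> finite \<sigma> \<and> (\<forall>x\<in>\<sigma>. d u x = m) \<and>
     (\<forall>x\<in>\<sigma>. \<forall>y\<in>\<sigma>. adj x y)"

lemma proj_antimono: "\<sigma> \<subseteq> \<tau> \<Longrightarrow> proj u \<tau> \<subseteq> proj u \<sigma>"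
  by (auto simp: proj_def)

lemma sphere_clique_subset:
  "sphere_clique u m \<tau> \<Longrightarrow> \<sigma> \<subseteq> \<tau> \<Longrightarrow> \<sigma> \<noteq> {} \<Longrightarrow> sphere_clique u m \<sigma>"
  unfolding sphere_clique_def by (auto intro: finite_subset)

lemma sphere_clique_singleton: "u \<in> V \<Longrightarrow> x \<in> V \<Longrightarrow> sphere_clique u (d u x) {x}"
  unfolding sphere_clique_def by (auto intro: adj_refl)

lemma sphere_clique_V: "sphere_clique u m \<sigma> \<Longrightarrow> x \<in> \<sigma> \<Longrightarrow> x \<in> V"
  unfolding sphere_clique_def using adj_V by blast

text \<open>Let \<open>v\<close> lie below the smaller clique and \<open>c\<close> below the edge
  from \<open>a\<close> to one of its vertices \<open>b\<close>. In the neighbourhood of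
  \<open>b\<close> the cycle \<open>v, x, a, c\<close> has a chord for every \<open>x\<close> of the
  clique. If \<open>v\<close> is not adjacent to \<open>a\<close>, the chord is always from
  \<open>x\<close> to \<open>c\<close>, and \<open>c\<close> lies below everything.\<close>

lemma proj_nonempty:
  assumes "finite \<sigma>" "\<sigma> \<noteq> {}" "sphere_clique u (Suc m) \<sigma>"
  shows "proj u \<sigma> \<noteq> {}"
  using assms
proof (induction \<sigma> rule: finite_ne_induct)
  case (singleton x)
  then have "u \<in> V" "x \<in> V" "d u x = Suc m"
    using adj_V by (auto simp: sphere_clique_def)
  then show ?case using ex_lower[of x u m] by (auto simp: proj_def)
next
  case (insert a \<sigma>)
  have "sphere_clique u (Suc m) \<sigma>"
    using sphere_clique_subset[OF insert.prems] insert.hyps by blast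
  then obtain v where v: "v \<in> proj u \<sigma>" using insert.IH by blast
  obtain b where b: "b \<in> \<sigma>" using insert.hyps by blast
  have u: "u \<in> V" and lev: "\<And>x. x \<in> insert a \<sigma> \<Longrightarrow> d u x = Suc m"
    and clique: "\<And>x y. x \<in> insert a \<sigma> \<Longrightarrow> y \<in> insert a \<sigma> \<Longrightarrow> adj x y"
    using insert.prems by (auto simp: sphere_clique_def)
  have vlev: "d u v = m" and vadj: "\<And>x. x \<in> \<sigma> \<Longrightarrow> adj x v"
    using v b lev[of b] by (auto simp: proj_def)
  obtain c where c: "adj a c" "adj b c" "d u c = m"
    using triangle_cond[OF u clique[of a b] lev lev] b by blast
  have vc: "adj c v" using lower_clique[OF u c(2) vadj[OF b] _ c(3) vlev] lev b by blast
  show ?case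
  proof (cases "adj a v")
    case True
    then have "v \<in> proj u (insert a \<sigma>)"
      using v vlev lev[of a] by (auto simp: proj_def)
    then show ?thesis by blast
  next
    case False
    have "adj x c" if x: "x \<in> \<sigma>" for x
    proof -
      have "adj v a \<or> adj x c"
        using link4[OF vadj[OF b] clique[of b x] clique[of b a] c(2) adj_sym[OF vadj[OF x]]
            clique[of x a] c(1) vc] b x by blast
      then show ?thesis using False adj_sym by blast
    qed
    then have "c \<in> proj u (insert a \<sigma>)" using c lev by (auto simp: proj_def)
    then show ?thesis by blast
  qed
qed

lemma sphere_clique_proj:
  assumes "sphere_clique u (Suc m) \<sigma>"
  shows "sphere_clique u m (proj u \<sigma>)"
proof -
  have *: "finite \<sigma>" "\<sigma> \<noteq> {}" "u \<in> V" "\<And>x. x \<in> \<sigma> \<Longrightarrow> d u x = Suc m"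
    using assms by (auto simp: sphere_clique_def)
  then obtain x where x: "x \<in> \<sigma>" by blast
  have "proj u \<sigma> \<subseteq> {y. adj x y}" using x by (auto simp: proj_def)
  then have "finite (proj u \<sigma>)" using finite_nbrs finite_subset by blast
  moreover have "adj y z" if "y \<in> proj u \<sigma>" "z \<in> proj u \<sigma>" for y z
    using lower_clique[of u x y z m] that x * by (auto simp: proj_def)
  moreover have "d u y = m" if "y \<in> proj u \<sigma>" for y
    using that x *(4)[OF x] by (auto simp: proj_def)
  ultimately show ?thesis
    using proj_nonempty[OF *(1,2) assms] *(3) by (simp add: sphere_clique_def)
qed

lemma sphere_clique_proj_iter:
  "sphere_clique u n \<sigma> \<Longrightarrow> i \<le> n \<Longrightarrow> sphere_clique u (n - i) ((proj u ^^ i) \<sigma>)"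
proof (induction i)
  case (Suc i)
  then have "sphere_clique u (Suc (n - Suc i)) ((proj u ^^ i) \<sigma>)"
    by (simp add: Suc_diff_Suc)
  then show ?case using sphere_clique_proj by simp
qed simp

lemma sphere_clique_zero: "sphere_clique u 0 \<sigma> \<Longrightarrow> \<sigma> = {u}"
  unfolding sphere_clique_def using d_zero adj_V by blast

section \<open>Itineraries towards a fixed target\<close>

definition close :: "'v \<Rightarrow> nat \<Rightarrow> 'v set \<Rightarrow> 'v set \<Rightarrow> bool" where
  "close u m \<sigma> \<tau> \<longleftrightarrow> sphere_clique u m \<sigma> \<and> sphere_clique u m \<tau> \<and>
     (sphere_clique u m (\<sigma> \<union> \<tau>) \<or> \<sigma> \<inter> \<tau> \<noteq> {})"

text \<open>The projection of a spanned clique is nonempty and lies in both projections, which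
  therefore meet. If \<open>z\<close> is a common vertex, both projections lie in the clique
  \<open>proj u {z}\<close>. So the two alternatives are exchanged in each step.\<close>

lemma close_proj:
  assumes "close u (Suc m) \<sigma> \<tau>"
  shows "close u m (proj u \<sigma>) (proj u \<tau>)"
proof -
  have st: "sphere_clique u (Suc m) \<sigma>" "sphere_clique u (Suc m) \<tau>"
    using assms by (auto simp: close_def)
  note pst = st[THEN sphere_clique_proj]
  consider "sphere_clique u (Suc m) (\<sigma> \<union> \<tau>)" | z where "z \<in> \<sigma>" "z \<in> \<tau>"
    using assms by (auto simp: close_def)
  then show ?thesis
  proof cases
    case 1
    have "proj u (\<sigma> \<union> \<tau>) \<subseteq> proj u \<sigma> \<inter> proj u \<tau>" by (simp add: proj_antimono)
    moreover have "proj u (\<sigma> \<union> \<tau>) \<noteq> {}"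
      using sphere_clique_proj[OF 1] by (simp add: sphere_clique_def)
    ultimately show ?thesis using pst by (auto simp: close_def)
  next
    case 2
    have "sphere_clique u (Suc m) {z}" using sphere_clique_subset[OF st(1)] 2 by blast
    then have "sphere_clique u m (proj u {z})" by (rule sphere_clique_proj)
    moreover have "proj u \<sigma> \<union> proj u \<tau> \<subseteq> proj u {z}" using 2 by (simp add: proj_antimono)
    moreover have "proj u \<sigma> \<union> proj u \<tau> \<noteq> {}" using pst by (simp add: sphere_clique_def)
    ultimately have "sphere_clique u m (proj u \<sigma> \<union> proj u \<tau>)"
      by (rule sphere_clique_subset)
    then show ?thesis using pst by (simp add: close_def)
  qed
qed

lemma close_proj_iter:
  "close u n \<sigma> \<tau> \<Longrightarrow> i \<le> n \<Longrightarrow> close u (n - i) ((proj u ^^ i) \<sigma>) ((proj u ^^ i) \<tau>)"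
proof (induction i)
  case (Suc i)
  then have "close u (Suc (n - Suc i)) ((proj u ^^ i) \<sigma>) ((proj u ^^ i) \<tau>)"
    by (simp add: Suc_diff_Suc)
  then show ?case using close_proj by simp
qed simp

lemma close_dist:
  assumes "close u m \<sigma> \<tau>" "x \<in> \<sigma>" "y \<in> \<tau>"
  shows "d x y \<le> 2"
proof -
  have V: "x \<in> V" "y \<in> V" using assms sphere_clique_V by (auto simp: close_def)
  have "adj x y" if "sphere_clique u m (\<sigma> \<union> \<tau>)"
    using that assms(2,3) unfolding sphere_clique_def by blast
  moreover have "adj x z" "adj z y" if "z \<in> \<sigma>" "z \<in> \<tau>" for z
    using that assms unfolding close_def sphere_clique_def by blast+
  ultimately consider "adj x y" | z where "adj x z" "adj z y"
    using assms(1) unfolding close_def by blast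
  then show ?thesis
  proof cases
    case 1
    then show ?thesis using d_adj[OF V] by simp
  next
    case 2
    then have "z \<in> V" "d x z \<le> 1" "d z y \<le> 1" using adj_V d_adj by metis+
    then show ?thesis using d_triangle[OF V(1) _ V(2), of z] by simp
  qed
qed

text \<open>The minimum lets the itinerary rest at \<open>{u}\<close> after arrival, as a path rests
  at its end point.\<close>

definition itinerary :: "'v \<Rightarrow> 'v \<Rightarrow> nat \<Rightarrow> 'v set" where
  "itinerary u w t = (proj u ^^ min t (d u w)) {w}"

lemma itinerary_clique:
  "u \<in> V \<Longrightarrow> w \<in> V \<Longrightarrow> sphere_clique u (d u w - min t (d u w)) (itinerary u w t)"
  unfolding itinerary_def by (intro sphere_clique_proj_iter sphere_clique_singleton) auto

lemma itinerary_end: "u \<in> V \<Longrightarrow> w \<in> V \<Longrightarrow> d u w \<le> t \<Longrightarrow> itinerary u w t = {u}"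
  using itinerary_clique[of u w t] sphere_clique_zero by simp

lemma itinerary_V: "u \<in> V \<Longrightarrow> w \<in> V \<Longrightarrow> x \<in> itinerary u w t \<Longrightarrow> x \<in> V"
  using itinerary_clique sphere_clique_V by blast

lemma itinerary_same:
  "u \<in> V \<Longrightarrow> w \<in> V \<Longrightarrow> x \<in> itinerary u w t \<Longrightarrow> y \<in> itinerary u w t \<Longrightarrow> d x y \<le> 1"
  using itinerary_clique[of u w t] d_adj itinerary_V by (metis sphere_clique_def)

text \<open>The itinerary from \<open>w\<close> is one step late: its first projection contains
  \<open>w'\<close>, so from there on the simplices are close if time \<open>t\<close> from
  \<open>w\<close> is matched with time \<open>t - 1\<close> from \<open>w'\<close>. This costs 2,
  and the step that the other itinerary is ahead costs 1.\<close>

lemma itinerary_start_lower: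
  assumes ww: "adj w w'" and u: "u \<in> V" and lev: "d u w = Suc (d u w')"
    and x: "x \<in> itinerary u w t" and y: "y \<in> itinerary u w' t"
  shows "d x y \<le> 3"
proof -
  have V: "w \<in> V" "w' \<in> V" using adj_V ww by blast+
  have xy: "x \<in> V" "y \<in> V" using itinerary_V u V x y by blast+
  define n where "n = d u w'"
  have "sphere_clique u (Suc n) {w}" using sphere_clique_singleton[OF u V(1)] lev n_def by simp
  then have "sphere_clique u n (proj u {w})" by (rule sphere_clique_proj)
  moreover have "w' \<in> proj u {w}" using ww lev by (simp add: proj_def)
  moreover have "sphere_clique u n {w'}" using sphere_clique_singleton[OF u V(2)] n_def by simp
  ultimately have cl: "close u n (proj u {w}) {w'}" by (auto simp: close_def)
  consider "t = 0" | i where "t = Suc i" "Suc i \<le> n" | "Suc n \<le> t"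
    by (cases t) force+
  then show ?thesis
  proof cases
    case 1
    then have "x = w" "y = w'" using x y by (auto simp: itinerary_def)
    then have "d x y \<le> 1" using d_adj[OF V] ww by simp
    then show ?thesis by simp
  next
    case 2
    let ?\<tau> = "(proj u ^^ i) {w'}"
    have "x \<in> (proj u ^^ i) (proj u {w})"
      using x 2 lev by (simp add: itinerary_def n_def funpow_Suc_right del: funpow.simps)
    moreover have cli: "close u (n - i) ((proj u ^^ i) (proj u {w})) ?\<tau>"
      using close_proj_iter[OF cl] 2 by simp
    moreover have "?\<tau> \<noteq> {}" using cli by (simp add: close_def sphere_clique_def)
    moreover have "y \<in> proj u ?\<tau>" using y 2 by (simp add: itinerary_def n_def)
    ultimately obtain z where "d x z \<le> 2" "adj z y"
      using close_dist by (fastforce simp: proj_def)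
    then show ?thesis using d_triangle[of x z y] xy d_adj[of z y] adj_V[of z y] by force
  next
    case 3
    then have "x = u" "y = u"
      using x y itinerary_end u V lev n_def by auto
    then show ?thesis using d_zero u by force
  qed
qed

theorem itinerary_adjacent_starts:
  assumes ww: "adj w w'" and u: "u \<in> V"
    and x: "x \<in> itinerary u w t" and y: "y \<in> itinerary u w' t"
  shows "d x y \<le> 3"
proof -
  have V: "w \<in> V" "w' \<in> V" using adj_V ww by blast+
  have xy: "x \<in> V" "y \<in> V" using itinerary_V u V x y by blast+
  consider "d u w = Suc (d u w')" | "d u w' = Suc (d u w)" | "d u w = d u w'"
    using d_step[OF ww u] d_step[OF adj_sym[OF ww] u] by linarith
  then show ?thesis
  proof cases
    case 1
    then show ?thesis using itinerary_start_lower assms by blast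
  next
    case 2
    then show ?thesis using itinerary_start_lower[OF adj_sym[OF ww] u 2 y x] d_sym xy by simp
  next
    case 3
    have "close u (d u w) {w} {w'}"
      using sphere_clique_singleton[OF u V(1)] sphere_clique_singleton[OF u V(2)] 3 ww
        adj_sym[OF ww] adj_refl V
      by (auto simp: close_def sphere_clique_def)
    then have "close u (d u w - min t (d u w)) (itinerary u w t) (itinerary u w' t)"
      using close_proj_iter 3 by (simp add: itinerary_def)
    then show ?thesis using close_dist x y by fastforce
  qed
qed

section \<open>Itineraries towards adjacent targets\<close>

lemma no_parallel_edges:
  assumes "adj u v" "adj y z" "d u y = Suc k" "d v y = Suc (Suc k)" "d v z = Suc k"
    "d u z = Suc (Suc k)"
  shows False
proof -
  have V: "u \<in> V" "v \<in> V" "y \<in> V" "z \<in> V" using adj_V assms by blast+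
  \<comment> \<open>This vertex lies below \<open>y\<close> towards \<open>u\<close> and, by the
    distances, also towards \<open>v\<close>. So does \<open>z\<close> towards \<open>v\<close>,
    hence \<open>y1\<close> and \<open>z\<close> are adjacent and \<open>z\<close> is too near to
    \<open>u\<close>.\<close>
  obtain y1 where y1: "adj y y1" "d u y1 = k" using ex_lower[of y u k] V assms by blast
  have "y1 \<in> V" using adj_V y1 by blast
  then have "d v y1 \<le> Suc k" "Suc k \<le> d v y1"
    using d_base_step[OF assms(1)] y1 d_step[OF adj_sym[OF y1(1)] V(2)] assms(4) by fastforce+
  then have "adj y1 z" using lower_clique[OF V(2) y1(1) assms(2,4)] assms(5) by simp
  then show False using d_step[of y1 z u] V y1 assms(6) by simp
qed

text \<open>The sets of first vertices of geodesics from \<open>x\<close> to two adjacent vertices \<open>u\<close>, \<open>v\<close> at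
  equal distance from \<open>x\<close> are nested. In a planar picture this is the Gauss--Bonnet formula for
  a geodesic triangle with base \<open>uv\<close>.\<close>

lemma no_diverging_geodesics:
  assumes "adj u v" "adj x y" "adj x z" "d u x = Suc (Suc m)" "d v x = Suc (Suc m)"
    "d u y = Suc m" "d v y = Suc (Suc m)" "d v z = Suc m" "d u z = Suc (Suc m)"
  shows False
  using assms(2-)
proof (induction m arbitrary: x y z)
  case 0
  have V: "u \<in> V" "v \<in> V" "x \<in> V" "y \<in> V" "z \<in> V" using adj_V assms(1) 0 by blast+
  obtain t where t: "adj u t" "adj v t" "d x t = Suc 0"
    using triangle_cond[OF V(3) assms(1), of "Suc 0"] 0 d_sym V by metis
  have tV: "t \<in> V" using t adj_V by blast
  have *: "d u t \<le> 1" "d v t \<le> 1" using t d_adj tV V by blast+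
  have "adj x t" using d_adj[of x t] t tV V by simp
  then have **: "d u t = 1" "d v t = 1"
    using * d_step[OF adj_sym[OF \<open>adj x t\<close>]] V 0 by fastforce+
  have ty: "adj t y" "adj t z"
    using lower_clique[OF V(1) \<open>adj x t\<close> 0(1) 0(3)] lower_clique[OF V(2) \<open>adj x t\<close> 0(2) 0(4)] ** 0
    by simp_all
  have uy: "adj y u" "adj v z" using d_adj V 0 adj_sym by (metis One_nat_def order_refl)+
  have na: "\<not> adj x u" "\<not> adj y v" "\<not> adj u z" "\<not> adj v x"
    using d_adj d_sym V 0 by (metis One_nat_def Suc_n_not_le_n)+
  have "\<not> adj z y" using no_parallel_edges[OF assms(1) _ 0(5,6,7,8)] adj_sym by blast
  \<comment> \<open>The cycle \<open>x, y, u, v, z\<close> lies in the neighbourhood of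
    \<open>t\<close>, and each of its five diagonals is excluded.\<close>
  moreover have "adj x u \<or> adj y v \<or> adj u z \<or> adj v x \<or> adj z y"
    by (rule link5[where c = t]) (use t ty uy \<open>adj x t\<close> 0 assms(1) in \<open>blast intro: adj_sym\<close>)+
  ultimately show False using na by blast
next
  case (Suc m)
  have V: "u \<in> V" "v \<in> V" "x \<in> V" "y \<in> V" "z \<in> V" using adj_V assms(1) Suc.prems by blast+
  obtain q where q: "adj u q" "adj v q" "d x q = Suc (Suc m)"
    using triangle_cond[OF V(3) assms(1), of "Suc (Suc m)"] Suc.prems d_sym V by metis
  have qV: "q \<in> V" using q adj_V by blast
  \<comment> \<open>The first vertex of a geodesic from \<open>x\<close> to \<open>q\<close>. It
    lies below \<open>x\<close> for both targets, hence is adjacent to \<open>y\<close> and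
    \<open>z\<close>; lower neighbours of these two edges give the same configuration at
    \<open>t\<close>, one step nearer to \<open>u\<close> and \<open>v\<close>.\<close>
  obtain t where t: "adj x t" "d q t = Suc m"
    using ex_lower[of x q "Suc m"] q qV V d_sym by metis
  have tV: "t \<in> V" using t adj_V by blast
  have tlev: "d u t = Suc (Suc m)" "d v t = Suc (Suc m)"
    using d_base_step[OF adj_sym[OF q(1)] tV] d_base_step[OF adj_sym[OF q(2)] tV] t
      d_step[OF adj_sym[OF t(1)]] V Suc.prems by fastforce+
  have ty: "adj t y" "adj t z"
    using lower_clique[OF V(1) t(1) Suc.prems(1) Suc.prems(3)]
      lower_clique[OF V(2) t(1) Suc.prems(2) Suc.prems(4)] tlev Suc.prems by simp_all
  obtain y1 where y1: "adj t y1" "adj y y1" "d u y1 = Suc m"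
    using triangle_cond[OF V(1) ty(1) tlev(1)] Suc.prems by blast
  obtain z1 where z1: "adj t z1" "adj z z1" "d v z1 = Suc m"
    using triangle_cond[OF V(2) ty(2) tlev(2)] Suc.prems by blast
  have yzV: "y1 \<in> V" "z1 \<in> V" using y1 z1 adj_V by blast+
  have "d v y1 = Suc (Suc m)"
    using d_step[OF adj_sym[OF y1(2)] V(2)] d_base_step[OF assms(1) yzV(1)] y1 Suc.prems by simp
  moreover have "d u z1 = Suc (Suc m)"
    using d_step[OF adj_sym[OF z1(2)] V(1)] d_base_step[OF adj_sym[OF assms(1)] yzV(2)] z1 Suc.prems
    by simp
  ultimately show False using Suc.IH[OF y1(1) z1(1) tlev y1(3) _ z1(3)] by blast
qed

text \<open>\<open>\<sigma>\<close> and \<open>\<rho>\<close> are the current simplices of the itineraries towards \<open>u\<close> and towards an adjacent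
  vertex \<open>v\<close> which is further away. The two itineraries agree until \<open>\<rho>\<close> contains a vertex which is
  not closer to \<open>u\<close> than to \<open>v\<close>; from the next step on, all of \<open>\<rho>\<close> has this property.\<close>

definition companion :: "'v \<Rightarrow> 'v \<Rightarrow> nat \<Rightarrow> 'v set \<Rightarrow> 'v set \<Rightarrow> bool" where
  "companion u v m \<sigma> \<rho> \<longleftrightarrow> sphere_clique u m \<sigma> \<and> sphere_clique v (Suc m) \<rho> \<and>
     sphere_clique v (Suc m) (\<sigma> \<union> \<rho>) \<and>
     (\<sigma> = {x \<in> \<rho>. d u x = m} \<or> (\<forall>x\<in>\<rho>. Suc m \<le> d u x))"

text \<open>On \<open>\<sigma>\<close> the distances to \<open>u\<close> and \<open>v\<close> differ
  by exactly one, so descending towards \<open>u\<close> also descends towards \<open>v\<close>.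
  While \<open>\<sigma> \<subseteq> \<rho>\<close>, both projections lie in the clique
  \<open>proj v \<sigma>\<close>. Once no vertex of \<open>\<rho>\<close> is nearer to
  \<open>u\<close> than to \<open>v\<close>, the nestedness of geodesics makes the projections span
  a clique.\<close>

lemma companion_proj:
  assumes uv: "adj u v" and comp: "companion u v (Suc m) \<sigma> \<rho>"
  shows "companion u v m (proj u \<sigma>) (proj v \<rho>)"
proof -
  have V: "u \<in> V" "v \<in> V" using adj_V uv by blast+
  have s: "sphere_clique u (Suc m) \<sigma>" and r: "sphere_clique v (Suc (Suc m)) \<rho>"
    and sr: "sphere_clique v (Suc (Suc m)) (\<sigma> \<union> \<rho>)"
    using comp by (auto simp: companion_def)
  have slev: "d u x = Suc m" "d v x = Suc (Suc m)" if "x \<in> \<sigma>" for x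
    using that s sr by (auto simp: sphere_clique_def)
  have rlev: "d v x = Suc (Suc m)" if "x \<in> \<rho>" for x
    using that r by (auto simp: sphere_clique_def)
  have srV: "x \<in> V" if "x \<in> \<sigma> \<union> \<rho>" for x using sphere_clique_V[OF sr that] .
  obtain x0 y0 where x0: "x0 \<in> \<rho>" and y0: "y0 \<in> \<sigma>" using r s by (auto simp: sphere_clique_def)
  have ps: "sphere_clique u m (proj u \<sigma>)" and pr: "sphere_clique v (Suc m) (proj v \<rho>)"
    using s r sphere_clique_proj by blast+
  have "sphere_clique v (Suc (Suc m)) \<sigma>" using sphere_clique_subset[OF sr] y0 by blast
  then have pvs: "sphere_clique v (Suc m) (proj v \<sigma>)" by (rule sphere_clique_proj)
  have sub: "proj u \<sigma> \<subseteq> proj v \<sigma>"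
  proof
    fix z assume z: "z \<in> proj u \<sigma>"
    show "z \<in> proj v \<sigma>" unfolding proj_def
    proof (intro CollectI ballI)
      fix x assume x: "x \<in> \<sigma>"
      have xz: "adj x z" "d u z = m" using z x slev by (auto simp: proj_def)
      then have "d v z \<le> Suc m" "d v x \<le> Suc (d v z)"
        using d_base_step[OF uv] d_step[OF adj_sym[OF xz(1)] V(2)] adj_V by blast+
      then show "adj x z \<and> Suc (d v z) = d v x" using xz slev[OF x] by simp
    qed
  qed
  have ne: "proj u \<sigma> \<union> proj v \<rho> \<noteq> {}" using pr by (simp add: sphere_clique_def)
  \<comment> \<open>A single vertex \<open>z\<close> of \<open>\<rho>\<close> suffices: it is
    adjacent to the whole projection, and one edge changes the distance from \<open>u\<close> by at
    most one.\<close>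
  have stay: "\<forall>x\<in>proj v \<rho>. Suc m \<le> d u x" if "z \<in> \<rho>" "Suc (Suc m) \<le> d u z" for z
    using that d_step[OF adj_sym V(1)] by (fastforce simp: proj_def)
  have sub_case: "sphere_clique v (Suc m) (proj u \<sigma> \<union> proj v \<rho>)" if "\<sigma> \<subseteq> \<rho>"
    using sphere_clique_subset[OF pvs _ ne] sub proj_antimono[OF that] by blast
  consider "\<sigma> = \<rho>" | z where "\<sigma> \<subseteq> \<rho>" "z \<in> \<rho>" "Suc (Suc m) \<le> d u z"
    | "\<forall>x\<in>\<rho>. Suc (Suc m) \<le> d u x"
  proof -
    have "Suc m \<le> d u x" if "x \<in> \<rho>" for x
      using d_base_step[OF uv srV[of x]] rlev[OF that] that by simp
    then have "Suc (Suc m) \<le> d u x" if "x \<in> \<rho>" "d u x \<noteq> Suc m" for x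
      using that by (metis le_antisym not_less_eq_eq)
    then show thesis using that comp unfolding companion_def by blast
  qed
  then show ?thesis
  proof cases
    case 1
    have "proj u \<sigma> = {x \<in> proj v \<rho>. d u x = m}"
      using sub ps slev 1 by (auto simp: sphere_clique_def proj_def)
    then show ?thesis using ps pr sub_case 1 by (simp add: companion_def)
  next
    case 2
    then show ?thesis using ps pr sub_case stay by (auto simp: companion_def)
  next
    case 3
    have "adj a b" if a: "a \<in> proj u \<sigma>" and b: "b \<in> proj v \<rho>" for a b
    proof -
      have xy: "adj x0 y0" using sr x0 y0 by (auto simp: sphere_clique_def)
      have ulev: "d u x0 = Suc (Suc m)"
        using d_step[OF adj_sym[OF xy] V(1)] slev[OF y0] 3 x0 by force
      have xb: "adj x0 b" "d v b = Suc m" using b x0 rlev[OF x0] by (auto simp: proj_def)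
      have bV: "b \<in> V" using xb adj_V by blast
      have ya: "adj y0 a" "d v a = Suc m"
        using subsetD[OF sub a] y0 slev[OF y0] by (auto simp: proj_def)
      have "Suc m \<le> d u b" using stay 3 x0 b by blast
      \<comment> \<open>Otherwise geodesics from \<open>x0\<close> through \<open>y0\<close> to
        \<open>u\<close> and through \<open>b\<close> to \<open>v\<close> would diverge.\<close>
      moreover have "d u b \<noteq> Suc (Suc m)"
        using no_diverging_geodesics[OF uv xy xb(1) ulev rlev[OF x0] slev[OF y0] xb(2)] by blast
      moreover have "d u b \<le> Suc (Suc m)" using d_base_step[OF adj_sym[OF uv] bV] xb by simp
      ultimately have "d u b = Suc m" by simp
      then have "adj y0 b" using lower_clique[OF V(1) xy xb(1) ulev] slev[OF y0] by simp
      then show ?thesis using lower_clique[OF V(2) ya(1) _ slev(2)[OF y0] ya(2) xb(2)] by simp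
    qed
    then have "sphere_clique v (Suc m) (proj u \<sigma> \<union> proj v \<rho>)"
      using pr sphere_clique_subset[OF pvs sub] ps adj_sym by (auto simp: sphere_clique_def)
    moreover have "\<forall>x\<in>proj v \<rho>. Suc m \<le> d u x" using stay 3 x0 by blast
    ultimately show ?thesis using ps pr by (simp add: companion_def)
  qed
qed

lemma itinerary_target_lower:
  assumes uv: "adj u v" and w: "w \<in> V" and lev: "d v w = Suc (d u w)"
    and x: "x \<in> itinerary u w t" and y: "y \<in> itinerary v w t"
  shows "d x y \<le> 1"
proof -
  have V: "u \<in> V" "v \<in> V" using adj_V uv by blast+
  have xy: "x \<in> V" "y \<in> V" using itinerary_V w V x y by blast+
  define n where "n = d u w"
  have comp: "companion u v (n - i) ((proj u ^^ i) {w}) ((proj v ^^ i) {w})" if "i \<le> n" for i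
    using that
  proof (induction i)
    case 0
    then show ?case
      using sphere_clique_singleton[OF V(1) w] sphere_clique_singleton[OF V(2) w] lev
      by (auto simp: companion_def n_def)
  next
    case (Suc i)
    then have "companion u v (Suc (n - Suc i)) ((proj u ^^ i) {w}) ((proj v ^^ i) {w})"
      by (simp add: Suc_diff_Suc)
    then show ?case using companion_proj[OF uv] by simp
  qed
  show ?thesis
  proof (cases "t \<le> n")
    case True
    then have "adj x y"
      using comp[OF True] x y lev by (auto simp: companion_def sphere_clique_def itinerary_def n_def)
    then show ?thesis using d_adj xy by blast
  next
    case False
    then have "x = u" "y = v" using x y itinerary_end V w lev n_def by auto
    then show ?thesis using uv d_adj V by blast
  qed
qed

theorem itinerary_adjacent_targets:
  assumes uv: "adj u v" and w: "w \<in> V"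
    and x: "x \<in> itinerary u w t" and y: "y \<in> itinerary v w t"
  shows "d x y \<le> 2"
proof -
  have V: "u \<in> V" "v \<in> V" using adj_V uv by blast+
  have xy: "x \<in> V" "y \<in> V" using itinerary_V w V x y by blast+
  consider "d v w = Suc (d u w)" | "d u w = Suc (d v w)" | "d u w = 0" "d v w = 0"
    | n where "d u w = Suc n" "d v w = Suc n"
    using d_base_step[OF uv w] d_base_step[OF adj_sym[OF uv] w] by (cases "d u w") force+
  then show ?thesis
  proof cases
    case 1
    then show ?thesis using itinerary_target_lower[OF uv w 1 x y] by simp
  next
    case 2
    then show ?thesis
      using itinerary_target_lower[OF adj_sym[OF uv] w 2 y x] d_sym[of x y] xy by simp
  next
    case 3
    then have "u = v" using d_zero V w by metis
    then show ?thesis using itinerary_same[OF V(2) w _ y] x by fastforce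
  next
    case (4 n)
    \<comment> \<open>Targets at equal distance from \<open>w\<close> are both compared with a
      common neighbour that is one step nearer to \<open>w\<close>, at cost 1 each.\<close>
    obtain q where q: "adj u q" "adj v q" "d w q = n"
      using triangle_cond[OF w uv, of n] 4 d_sym V w by metis
    have qV: "q \<in> V" using adj_V q by blast
    have qw: "d u w = Suc (d q w)" "d v w = Suc (d q w)" using 4 q d_sym[OF qV w] by simp_all
    obtain z where z: "z \<in> itinerary q w t"
      using itinerary_clique[OF qV w, of t] by (auto simp: sphere_clique_def)
    have "d z x \<le> 1" "d z y \<le> 1"
      using itinerary_target_lower[OF adj_sym[OF q(1)] w qw(1) z x]
        itinerary_target_lower[OF adj_sym[OF q(2)] w qw(2) z y] .
    moreover have "z \<in> V" using itinerary_V[OF qV w z] .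
    ultimately show ?thesis using d_triangle[of x z y] d_sym[of x z] xy by simp
  qed
qed

end

section \<open>Groups with a bridged Cayley graph\<close>

primrec accepts :: "('q \<times> 'b \<times> 'q) set \<Rightarrow> 'q set \<Rightarrow> 'q \<Rightarrow> 'b list \<Rightarrow> bool" where
  "accepts \<Delta> F q [] \<longleftrightarrow> q \<in> F"
| "accepts \<Delta> F q (a # w) \<longleftrightarrow> (\<exists>q'. (q, a, q') \<in> \<Delta> \<and> accepts \<Delta> F q' w)"

text \<open>The subset construction; the injection \<open>e\<close> numbers the sets of states, as a
  deterministic automaton has natural numbers for its states.\<close>

lemma regular_language_accepts:
  fixes \<Delta> :: "('q \<times> 'b \<times> 'q) set"
  assumes Q: "finite Q" "I \<subseteq> Q" and \<Delta>: "\<And>q a q'. (q, a, q') \<in> \<Delta> \<Longrightarrow> q' \<in> Q"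
  shows "regular_language A {w \<in> lists A. \<exists>q\<in>I. accepts \<Delta> F q w}"
proof -
  define step where "step X a = {q'. \<exists>q\<in>X. (q, a, q') \<in> \<Delta>}" for X :: "'q set" and a :: 'b
  have step_Q: "step X a \<subseteq> Q" for X a using \<Delta> by (auto simp: step_def)
  obtain e :: "'q set \<Rightarrow> nat" where e: "inj_on e (Pow Q)"
    using finite_imp_inj_to_nat_seg[of "Pow Q"] Q by auto
  define d where "d k = the_inv_into (Pow Q) e k" for k
  have d: "d (e X) = X" if "X \<subseteq> Q" for X
    unfolding d_def using the_inv_into_f_f[OF e, of X] that by simp
  have run: "foldl (\<lambda>k a. e (step (d k) a)) (e X) w = e (foldl step X w)" if "X \<subseteq> Q" for X w
    using that by (induction w arbitrary: X) (simp_all add: d step_Q)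
  have run_Q: "foldl step X w \<subseteq> Q" if "X \<subseteq> Q" for X w
    using that by (induction w arbitrary: X) (simp_all add: step_Q)
  have acc: "foldl step X w \<inter> F \<noteq> {} \<longleftrightarrow> (\<exists>q\<in>X. accepts \<Delta> F q w)" for X w
    by (induction w arbitrary: X) (auto simp: step_def)
  have "foldl (\<lambda>k a. e (step (d k) a)) (e I) w \<in> e ` {X \<in> Pow Q. X \<inter> F \<noteq> {}} \<longleftrightarrow>
      (\<exists>q\<in>I. accepts \<Delta> F q w)" for w
    unfolding run[OF Q(2)] acc[symmetric] using run_Q[OF Q(2), of w] inj_onD[OF e] by blast
  then have "{w \<in> lists A. \<exists>q\<in>I. accepts \<Delta> F q w} =
      {w \<in> lists A. foldl (\<lambda>k a. e (step (d k) a)) (e I) w \<in> e ` {X \<in> Pow Q. X \<inter> F \<noteq> {}}}"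
    by simp
  moreover have "finite (e ` Pow Q)" "e I \<in> e ` Pow Q"
    "e ` {X \<in> Pow Q. X \<inter> F \<noteq> {}} \<subseteq> e ` Pow Q"
    "\<forall>k\<in>e ` Pow Q. \<forall>a\<in>A. e (step (d k) a) \<in> e ` Pow Q"
    using Q step_Q by auto
  ultimately show ?thesis unfolding regular_language_def
    by (intro exI[of _ "e ` Pow Q"] exI[of _ "e I"] exI[of _ "e ` {X \<in> Pow Q. X \<inter> F \<noteq> {}}"]
        exI[of _ "\<lambda>k a. e (step (d k) a)"]) simp
qed

text \<open>The conditions of a bridged graph for the base point \<open>\<one>\<close> only, in
  terms of length; left translation carries them to every base point.\<close>

locale bridged_group = group G for G (structure) +
  fixes A :: "'a set" and len :: "'a \<Rightarrow> nat"
  assumes gens: "finite A" "A \<subseteq> carrier G"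
    and gens_inv: "a \<in> A \<Longrightarrow> inv a \<in> A"
    and gens_one: "\<one> \<in> A"
    and len_zero: "g \<in> carrier G \<Longrightarrow> len g = 0 \<longleftrightarrow> g = \<one>"
    and len_step: "g \<in> carrier G \<Longrightarrow> a \<in> A \<Longrightarrow> len (g \<otimes> a) \<le> Suc (len g)"
    and len_lower: "g \<in> carrier G \<Longrightarrow> 0 < len g \<Longrightarrow> \<exists>a\<in>A. len (g \<otimes> a) < len g"
    and len_clique: "\<lbrakk>g \<in> carrier G; a \<in> A; b \<in> A; len (g \<otimes> a) < len g; len (g \<otimes> b) < len g\<rbrakk>
      \<Longrightarrow> inv a \<otimes> b \<in> A"
    and len_flat: "\<lbrakk>g \<in> carrier G; a \<in> A; len (g \<otimes> a) = len g; 0 < len g\<rbrakk>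
      \<Longrightarrow> \<exists>b\<in>A. len (g \<otimes> b) < len g \<and> inv b \<otimes> a \<in> A"
    and gens_cycle4: "\<lbrakk>a \<in> A; b \<in> A; c \<in> A; e \<in> A;
        inv a \<otimes> b \<in> A; inv b \<otimes> c \<in> A; inv c \<otimes> e \<in> A; inv e \<otimes> a \<in> A\<rbrakk>
      \<Longrightarrow> inv a \<otimes> c \<in> A \<or> inv b \<otimes> e \<in> A"
    and gens_cycle5: "\<lbrakk>a \<in> A; b \<in> A; c \<in> A; e \<in> A; f \<in> A;
        inv a \<otimes> b \<in> A; inv b \<otimes> c \<in> A; inv c \<otimes> e \<in> A; inv e \<otimes> f \<in> A; inv f \<otimes> a \<in> A\<rbrakk>
      \<Longrightarrow> inv a \<otimes> c \<in> A \<or> inv b \<otimes> e \<in> A \<or> inv c \<otimes> f \<in> A \<or> inv e \<otimes> a \<in> A \<or> inv f \<otimes> b \<in> A"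
begin

lemma gens_closed: "a \<in> A \<Longrightarrow> a \<in> carrier G"
  using gens by blast

lemma inv_mult_cancel: "x \<in> carrier G \<Longrightarrow> y \<in> carrier G \<Longrightarrow> inv x \<otimes> (x \<otimes> y) = y"
  by (simp add: m_assoc[symmetric])

lemma mult_inv_cancel: "x \<in> carrier G \<Longrightarrow> y \<in> carrier G \<Longrightarrow> x \<otimes> (inv x \<otimes> y) = y"
  by (simp add: m_assoc[symmetric])

lemma inv_mult_translate:
  "c \<in> carrier G \<Longrightarrow> x \<in> carrier G \<Longrightarrow> y \<in> carrier G \<Longrightarrow> inv (c \<otimes> x) \<otimes> (c \<otimes> y) = inv x \<otimes> y"
  by (simp add: inv_mult_group m_assoc inv_mult_cancel)

lemma len_one: "len \<one> = 0"
  using len_zero by simp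

lemma len_mult: "g \<in> carrier G \<Longrightarrow> h \<in> carrier G \<Longrightarrow> len (g \<otimes> h) \<le> len g + len h"
proof (induction "len h" arbitrary: h rule: less_induct)
  case less
  show ?case
  proof (cases "len h = 0")
    case True
    then show ?thesis using less.prems len_zero by simp
  next
    case False
    then obtain a where a: "a \<in> A" "len (h \<otimes> a) < len h" using len_lower less.prems by blast
    have ac: "a \<in> carrier G" "inv a \<in> A" using a gens_closed gens_inv by auto
    have "g \<otimes> h = (g \<otimes> (h \<otimes> a)) \<otimes> inv a"
      using less.prems ac by (simp add: m_assoc)
    then have "len (g \<otimes> h) \<le> Suc (len (g \<otimes> (h \<otimes> a)))"
      using len_step[OF _ ac(2), of "g \<otimes> (h \<otimes> a)"] less.prems ac by simp
    also have "len (g \<otimes> (h \<otimes> a)) \<le> len g + len (h \<otimes> a)"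
      using less.hyps[OF a(2)] less.prems ac by simp
    finally show ?thesis using a(2) by simp
  qed
qed

lemma len_gen: "a \<in> A \<Longrightarrow> len a \<le> 1"
  using len_step[of \<one> a] len_one gens_closed by simp

lemma len_inv_le: "g \<in> carrier G \<Longrightarrow> len (inv g) \<le> len g"
proof (induction "len g" arbitrary: g rule: less_induct)
  case less
  show ?case
  proof (cases "len g = 0")
    case True
    then show ?thesis using less.prems len_zero by simp
  next
    case False
    then obtain a where a: "a \<in> A" "len (g \<otimes> a) < len g" using len_lower less.prems by blast
    have ac: "a \<in> carrier G" using a gens_closed by auto
    have "inv g = a \<otimes> inv (g \<otimes> a)"
      using less.prems ac by (simp add: inv_mult_group mult_inv_cancel)
    then have "len (inv g) \<le> len a + len (inv (g \<otimes> a))"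
      using len_mult[of a "inv (g \<otimes> a)"] less.prems ac by simp
    then show ?thesis using less.hyps[OF a(2)] len_gen[OF a(1)] a(2) less.prems ac by simp
  qed
qed

lemma len_inv: "g \<in> carrier G \<Longrightarrow> len (inv g) = len g"
  using len_inv_le[of g] len_inv_le[of "inv g"] by simp

lemma len_le_one_iff: "g \<in> carrier G \<Longrightarrow> len g \<le> 1 \<longleftrightarrow> g \<in> A"
proof
  assume g: "g \<in> carrier G" "len g \<le> 1"
  show "g \<in> A"
  proof (cases "len g = 0")
    case True
    then show ?thesis using g len_zero gens_one by simp
  next
    case False
    then obtain a where a: "a \<in> A" "len (g \<otimes> a) = 0" using len_lower[OF g(1)] g(2) by force
    then have "g \<otimes> a = \<one>" using len_zero[of "g \<otimes> a"] g gens_closed by simp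
    then show ?thesis using inv_equality[of g a] a gens_inv gens_closed g inv_inv by metis
  qed
qed (rule len_gen)

definition dist :: "'a \<Rightarrow> 'a \<Rightarrow> nat" where
  "dist g h = len (inv g \<otimes> h)"

definition adj :: "'a \<Rightarrow> 'a \<Rightarrow> bool" where
  "adj g h \<longleftrightarrow> g \<in> carrier G \<and> h \<in> carrier G \<and> inv g \<otimes> h \<in> A"

lemma adj_edge: "adj x y \<Longrightarrow> u \<in> carrier G \<Longrightarrow>
    dist u y = len (inv u \<otimes> x \<otimes> (inv x \<otimes> y))"
  by (simp add: dist_def adj_def m_assoc mult_inv_cancel)

lemma adj_common: "adj c x \<Longrightarrow> adj c y \<Longrightarrow> adj x y \<longleftrightarrow> inv (inv c \<otimes> x) \<otimes> (inv c \<otimes> y) \<in> A"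
  using inv_mult_translate[of "inv c" x y] by (simp add: adj_def)

sublocale bridged "carrier G" adj dist
proof
  show "x \<in> carrier G \<and> y \<in> carrier G" if "adj x y" for x y using that by (simp add: adj_def)
  show "adj x x" if "x \<in> carrier G" for x using that gens_one by (simp add: adj_def)
  show sym: "adj y x" if "adj x y" for x y
  proof -
    have "inv (inv x \<otimes> y) \<in> A" using gens_inv that by (simp add: adj_def)
    then show ?thesis using that by (simp add: adj_def inv_mult_group)
  qed
  show "finite {y. adj x y}" for x
  proof (rule finite_subset)
    show "{y. adj x y} \<subseteq> (\<lambda>a. x \<otimes> a) ` A"
      using mult_inv_cancel by (force simp: adj_def image_iff)
  qed (use gens in simp)
  show "dist x y = dist y x" if "x \<in> carrier G" "y \<in> carrier G" for x y
    using len_inv[of "inv x \<otimes> y"] that by (simp add: dist_def inv_mult_group)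
  show "dist x z \<le> dist x y + dist y z"
    if "x \<in> carrier G" "y \<in> carrier G" "z \<in> carrier G" for x y z
    using len_mult[of "inv x \<otimes> y" "inv y \<otimes> z"] that
    by (simp add: dist_def m_assoc mult_inv_cancel)
  show "dist x y = 0 \<longleftrightarrow> x = y" if "x \<in> carrier G" "y \<in> carrier G" for x y
    using len_zero[of "inv x \<otimes> y"] that inv_solve_left'[of "\<one>" x y] by (auto simp: dist_def)
  show "dist x y \<le> 1 \<longleftrightarrow> adj x y" if "x \<in> carrier G" "y \<in> carrier G" for x y
    using len_le_one_iff[of "inv x \<otimes> y"] that by (simp add: dist_def adj_def)
  show "\<exists>y. adj x y \<and> dist u y = m"
    if "x \<in> carrier G" "u \<in> carrier G" "dist u x = Suc m" for x u m
  proof -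
    have len: "len (inv u \<otimes> x) = Suc m" "inv u \<otimes> x \<in> carrier G" using that by (simp_all add: dist_def)
    then obtain a where a: "a \<in> A" "len (inv u \<otimes> x \<otimes> a) < Suc m"
      using len_lower[of "inv u \<otimes> x"] by auto
    \<comment> \<open>One generator changes the length by at most one, so shorter means shorter by
      exactly one.\<close>
    have "Suc m \<le> Suc (len (inv u \<otimes> x \<otimes> a))"
      using len_step[of "inv u \<otimes> x \<otimes> a" "inv a"] a that len gens_closed gens_inv by (simp add: m_assoc)
    then have "dist u (x \<otimes> a) = m" using a that gens_closed by (simp add: dist_def m_assoc)
    moreover have "adj x (x \<otimes> a)" using a that gens_closed by (simp add: adj_def inv_mult_cancel)
    ultimately show ?thesis by blast
  qed
  show "adj y z" if "u \<in> carrier G" "adj x y" "adj x z" "dist u x = Suc m" "dist u y = m" "dist u z = m"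
    for u x y z m
    using len_clique[of "inv u \<otimes> x" "inv x \<otimes> y" "inv x \<otimes> z"] that
      adj_edge[OF that(2,1)] adj_edge[OF that(3,1)] adj_common[OF that(2,3)]
    by (simp add: dist_def adj_def)
  show "\<exists>z. adj x z \<and> adj y z \<and> dist u z = m"
    if u: "u \<in> carrier G" and xy: "adj x y" and lev: "dist u x = Suc m" "dist u y = Suc m" for u x y m
  proof -
    have carr: "x \<in> carrier G" "y \<in> carrier G" "inv x \<otimes> y \<in> A" using xy by (auto simp: adj_def)
    obtain b where b: "b \<in> A" "len (inv u \<otimes> x \<otimes> b) < Suc m" "inv b \<otimes> (inv x \<otimes> y) \<in> A"
      using len_flat[of "inv u \<otimes> x" "inv x \<otimes> y"] adj_edge[OF xy u] lev carr u
      by (auto simp: dist_def)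
    have "Suc m \<le> Suc (len (inv u \<otimes> x \<otimes> b))"
      using len_step[of "inv u \<otimes> x \<otimes> b" "inv b"] b u carr lev gens_closed gens_inv
      by (simp add: m_assoc dist_def)
    then have "dist u (x \<otimes> b) = m" using b u carr gens_closed by (simp add: dist_def m_assoc)
    moreover have "adj x (x \<otimes> b)" using b carr gens_closed by (simp add: adj_def inv_mult_cancel)
    moreover have "adj (x \<otimes> b) y"
      using b carr gens_closed by (simp add: adj_def inv_mult_group m_assoc)
    ultimately show ?thesis using sym by blast
  qed
  show "adj x1 x3 \<or> adj x2 x4"
    if "adj c x1" "adj c x2" "adj c x3" "adj c x4" "adj x1 x2" "adj x2 x3" "adj x3 x4" "adj x4 x1"
    for c x1 x2 x3 x4
    using that gens_cycle4[of "inv c \<otimes> x1" "inv c \<otimes> x2" "inv c \<otimes> x3" "inv c \<otimes> x4"]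
      adj_common[OF that(1,2)] adj_common[OF that(2,3)] adj_common[OF that(3,4)]
      adj_common[OF that(4,1)] adj_common[OF that(1,3)] adj_common[OF that(2,4)]
    unfolding adj_def[of c] by blast
  show "adj x1 x3 \<or> adj x2 x4 \<or> adj x3 x5 \<or> adj x4 x1 \<or> adj x5 x2"
    if "adj c x1" "adj c x2" "adj c x3" "adj c x4" "adj c x5"
      "adj x1 x2" "adj x2 x3" "adj x3 x4" "adj x4 x5" "adj x5 x1"
    for c x1 x2 x3 x4 x5
    using that gens_cycle5[of "inv c \<otimes> x1" "inv c \<otimes> x2" "inv c \<otimes> x3" "inv c \<otimes> x4" "inv c \<otimes> x5"]
      adj_common[OF that(1,2)] adj_common[OF that(2,3)] adj_common[OF that(3,4)]
      adj_common[OF that(4,5)] adj_common[OF that(5,1)]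
      adj_common[OF that(1,3)] adj_common[OF that(2,4)] adj_common[OF that(3,5)]
      adj_common[OF that(4,1)] adj_common[OF that(5,2)]
    unfolding adj_def[of c] by blast
qed

lemma dist_translate:
  "c \<in> carrier G \<Longrightarrow> x \<in> carrier G \<Longrightarrow> y \<in> carrier G \<Longrightarrow> dist (c \<otimes> x) (c \<otimes> y) = dist x y"
  by (simp add: dist_def inv_mult_translate)

lemma adj_translate:
  "c \<in> carrier G \<Longrightarrow> x \<in> carrier G \<Longrightarrow> y \<in> carrier G \<Longrightarrow> adj (c \<otimes> x) (c \<otimes> y) \<longleftrightarrow> adj x y"
  by (simp add: adj_def inv_mult_translate)

lemma dist_one: "g \<in> carrier G \<Longrightarrow> dist \<one> g = len g"
  by (simp add: dist_def)

text \<open>The set \<open>\<sigma>\<close> is nonempty because the projection of the empty set is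
  the whole type, including elements outside the group.\<close>

lemma proj_translate:
  assumes c: "c \<in> carrier G" and u: "u \<in> carrier G" and \<sigma>: "\<sigma> \<subseteq> carrier G" "\<sigma> \<noteq> {}"
  shows "proj (c \<otimes> u) ((\<otimes>) c ` \<sigma>) = (\<otimes>) c ` proj u \<sigma>"
proof -
  have eq: "c \<otimes> z \<in> proj (c \<otimes> u) ((\<otimes>) c ` \<sigma>) \<longleftrightarrow> z \<in> proj u \<sigma>" if "z \<in> carrier G" for z
    using that \<sigma> c u dist_translate adj_translate unfolding proj_def by (auto simp: subset_iff)
  have closed: "z \<in> carrier G" if "z \<in> proj v \<tau>" "\<tau> \<noteq> {}" for z v \<tau>
    using that by (auto simp: proj_def adj_def)
  show ?thesis
  proof (intro equalityI subsetI)
    fix z assume z: "z \<in> proj (c \<otimes> u) ((\<otimes>) c ` \<sigma>)"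
    then have "z \<in> carrier G" using closed \<sigma>(2) by blast
    then have "z = c \<otimes> (inv c \<otimes> z)" "inv c \<otimes> z \<in> carrier G" using c by (simp_all add: mult_inv_cancel)
    then show "z \<in> (\<otimes>) c ` proj u \<sigma>" using eq[of "inv c \<otimes> z"] z by auto
  next
    fix z assume "z \<in> (\<otimes>) c ` proj u \<sigma>"
    then show "z \<in> proj (c \<otimes> u) ((\<otimes>) c ` \<sigma>)" using eq closed \<sigma>(2) by blast
  qed
qed

lemma proj_iter_translate:
  assumes c: "c \<in> carrier G" and u: "u \<in> carrier G" and \<sigma>: "sphere_clique u n \<sigma>" and i: "i \<le> n"
  shows "(proj (c \<otimes> u) ^^ i) ((\<otimes>) c ` \<sigma>) = (\<otimes>) c ` (proj u ^^ i) \<sigma>"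
  using i
proof (induction i)
  case (Suc i)
  have cl: "sphere_clique u (n - i) ((proj u ^^ i) \<sigma>)" using sphere_clique_proj_iter[OF \<sigma>] Suc by simp
  then have "(proj u ^^ i) \<sigma> \<subseteq> carrier G" "(proj u ^^ i) \<sigma> \<noteq> {}"
    using sphere_clique_V[OF cl] by (auto simp: sphere_clique_def)
  then show ?case using Suc proj_translate[OF c u] by simp
qed simp

lemma itinerary_translate:
  assumes "c \<in> carrier G" "u \<in> carrier G" "w \<in> carrier G"
  shows "itinerary (c \<otimes> u) (c \<otimes> w) t = (\<otimes>) c ` itinerary u w t"
  using proj_iter_translate[OF assms(1,2) sphere_clique_singleton[OF assms(2,3)], of "min t (dist u w)"]
  by (simp add: itinerary_def dist_translate assms)

section \<open>Words, the Cayley distance and the language\<close>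

lemma word_value_Nil: "word_value G [] = \<one>"
  by (simp add: word_value_def)

lemma word_value_Cons: "word_value G (a # w) = a \<otimes> word_value G w"
  by (simp add: word_value_def)

lemma word_value_closed: "w \<in> lists A \<Longrightarrow> word_value G w \<in> carrier G"
  by (induction w) (auto simp: word_value_Nil word_value_Cons gens_closed)

lemma word_value_append:
  "v \<in> lists A \<Longrightarrow> w \<in> lists A \<Longrightarrow> word_value G (v @ w) = word_value G v \<otimes> word_value G w"
  by (induction v) (auto simp: word_value_Nil word_value_Cons word_value_closed gens_closed m_assoc)

lemma len_word_value: "w \<in> lists A \<Longrightarrow> len (word_value G w) \<le> length w"
proof (induction w)
  case (Cons a w)
  then show ?case
    using len_mult[of a "word_value G w"] len_gen[of a] word_value_closed[of w] gens_closed
    by (force simp: word_value_Cons)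
qed (simp add: word_value_Nil len_one)

lemma ex_geodesic_word: "g \<in> carrier G \<Longrightarrow> \<exists>w\<in>lists A. length w = len g \<and> word_value G w = g"
proof (induction "len g" arbitrary: g)
  case 0
  then show ?case using len_zero by (intro bexI[of _ "[]"]) (auto simp: word_value_Nil)
next
  case (Suc n)
  then have "dist \<one> g = Suc n" using dist_one by simp
  then obtain h where h: "adj g h" "dist \<one> h = n" using ex_lower Suc.prems by blast
  then have hc: "h \<in> carrier G" "inv h \<otimes> g \<in> A" using adj_sym by (auto simp: adj_def)
  then obtain w where w: "w \<in> lists A" "length w = n" "word_value G w = h"
    using Suc.hyps(1)[of h] h dist_one by auto
  then have "w @ [inv h \<otimes> g] \<in> lists A" "word_value G (w @ [inv h \<otimes> g]) = g"
    using hc Suc.prems by (simp_all add: word_value_append word_value_Nil word_value_Cons mult_inv_cancel)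
  then show ?case using w Suc.hyps(2) by (intro bexI[of _ "w @ [inv h \<otimes> g]"]) auto
qed

lemma cayley_dist_eq:
  assumes "g \<in> carrier G" "h \<in> carrier G"
  shows "cayley_dist G A g h = dist g h"
  unfolding cayley_dist_def
proof (rule Least_equality)
  obtain w where w: "w \<in> lists A" "length w = len (inv g \<otimes> h)" "word_value G w = inv g \<otimes> h"
    using ex_geodesic_word[of "inv g \<otimes> h"] assms by auto
  then show "\<exists>w\<in>lists A. length w = dist g h \<and> g \<otimes> word_value G w = h"
    using assms by (auto simp: dist_def mult_inv_cancel)
  fix n assume "\<exists>w\<in>lists A. length w = n \<and> g \<otimes> word_value G w = h"
  then obtain w where w: "w \<in> lists A" "length w = n" "g \<otimes> word_value G w = h" by blast
  then have "inv g \<otimes> h = word_value G w" using assms word_value_closed inv_mult_cancel by blast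
  then show "dist g h \<le> n" using len_word_value[OF w(1)] w(2) by (simp add: dist_def)
qed

text \<open>A path labelled \<open>w\<close> that ends at \<open>\<one>\<close> starts at the
  inverse of the value of \<open>w\<close>; so the current vertex is always the inverse of the value
  of the unread word.\<close>

primrec good :: "'a set \<Rightarrow> 'a list \<Rightarrow> bool" where
  "good \<sigma> [] \<longleftrightarrow> \<sigma> = {\<one>}"
| "good \<sigma> (a # w) \<longleftrightarrow> inv (word_value G (a # w)) \<in> \<sigma> \<and> good (proj \<one> \<sigma>) w"

definition lang :: "'a list set" where
  "lang = {w \<in> lists A. good {inv (word_value G w)} w}"

lemma good_mem: "good \<sigma> w \<Longrightarrow> inv (word_value G w) \<in> \<sigma>"
  by (cases w) (auto simp: word_value_Nil)

lemma good_iter: "good \<sigma> w \<Longrightarrow> t \<le> length w \<Longrightarrow> inv (word_value G (drop t w)) \<in> (proj \<one> ^^ t) \<sigma>"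
proof (induction w arbitrary: \<sigma> t)
  case (Cons a w)
  then show ?case
    by (cases t) (simp_all add: funpow_swap1 flip: funpow_Suc_right)
qed (simp add: word_value_Nil)

text \<open>Projections from the sphere of radius \<open>n\<close> arrive at \<open>{\<one>}\<close>
  after exactly \<open>n\<close> steps; one step more gives the empty set, for which no word is
  good. Hence words of the language are geodesic.\<close>

lemma good_length: "good \<sigma> w \<Longrightarrow> sphere_clique \<one> n \<sigma> \<Longrightarrow> length w = n"
proof (induction w arbitrary: \<sigma> n)
  case Nil
  then show ?case by (simp add: sphere_clique_def dist_one len_one)
next
  case (Cons a w)
  show ?case
  proof (cases n)
    case 0
    then have "\<sigma> = {\<one>}" using sphere_clique_zero Cons.prems by blast
    then have "proj \<one> \<sigma> = {}" by (simp add: proj_def dist_one len_one)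
    then show ?thesis using Cons.prems good_mem[of "{}" w] by simp
  next
    case (Suc m)
    then have "sphere_clique \<one> m (proj \<one> \<sigma>)" using sphere_clique_proj Cons.prems(2) by blast
    then show ?thesis using Cons.IH[of "proj \<one> \<sigma>" m] Cons.prems(1) Suc by simp
  qed
qed

text \<open>Left multiplication by the end point carries the path that ends at \<open>\<one>\<close>
  to the path that starts at \<open>g\<close>.\<close>

lemma lang_itinerary:
  assumes w: "w \<in> lang" and g: "g \<in> carrier G"
  shows "path_at G g w t \<in> itinerary (g \<otimes> word_value G w) g t"
proof -
  have wA: "w \<in> lists A" "take t w \<in> lists A" "drop t w \<in> lists A"
    using w set_take_subset[of t w] set_drop_subset[of t w] by (auto simp: lang_def in_lists_conv_set)
  let ?x = "inv (word_value G w)" and ?u = "g \<otimes> word_value G w"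
  note carr = wA[THEN word_value_closed]
  have x: "?x \<in> carrier G" using carr by simp
  have "length w = dist \<one> ?x"
    using good_length[OF _ sphere_clique_singleton[OF one_closed x]] w by (simp add: lang_def)
  moreover have "inv (word_value G (drop (min t (length w)) w)) \<in> (proj \<one> ^^ min t (length w)) {?x}"
    using good_iter[of "{?x}" w] w by (simp add: lang_def)
  moreover have "drop (min t (length w)) w = drop t w" by (simp add: min_def)
  ultimately have "inv (word_value G (drop t w)) \<in> itinerary \<one> ?x t" by (simp add: itinerary_def)
  then have "?u \<otimes> inv (word_value G (drop t w)) \<in> itinerary (?u \<otimes> \<one>) (?u \<otimes> ?x) t"
    using itinerary_translate[of ?u \<one> ?x t] g carr by simp
  moreover have "?u \<otimes> inv (word_value G (drop t w)) = path_at G g w t"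
    using word_value_append[OF wA(2,3)] carr g by (simp add: path_at_def m_assoc)
  moreover have "?u \<otimes> ?x = g" using carr g by (simp add: m_assoc)
  ultimately show ?thesis using g carr by simp
qed

text \<open>Any vertex of the projection may be chosen as the next one, since it is adjacent to all
  of \<open>\<sigma>\<close>.\<close>

lemma good_exists:
  "sphere_clique \<one> n \<sigma> \<Longrightarrow> x \<in> \<sigma> \<Longrightarrow> \<exists>w\<in>lists A. good \<sigma> w \<and> inv (word_value G w) = x"
proof (induction n arbitrary: \<sigma> x)
  case 0
  then have "\<sigma> = {\<one>}" using sphere_clique_zero by blast
  then show ?case using 0 by (intro bexI[of _ "[]"]) (auto simp: word_value_Nil)
next
  case (Suc n)
  have cl: "sphere_clique \<one> n (proj \<one> \<sigma>)" using sphere_clique_proj Suc.prems by blast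
  then obtain y where y: "y \<in> proj \<one> \<sigma>" by (auto simp: sphere_clique_def)
  then obtain w where w: "w \<in> lists A" "good (proj \<one> \<sigma>) w" "inv (word_value G w) = y"
    using Suc.IH[OF cl] by blast
  have xy: "adj x y" using y Suc.prems by (auto simp: proj_def)
  then have carr: "x \<in> carrier G" "y \<in> carrier G" "inv x \<otimes> y \<in> A" by (auto simp: adj_def)
  have wc: "word_value G w = inv y" using w(3) word_value_closed[OF w(1)] by auto
  have "word_value G ((inv x \<otimes> y) # w) = inv x"
    using carr wc by (simp add: word_value_Cons m_assoc)
  then show ?case using w carr Suc.prems by (intro bexI[of _ "(inv x \<otimes> y) # w"]) auto
qed

lemma lang_surj: "word_value G ` lang = carrier G"
proof
  show "word_value G ` lang \<subseteq> carrier G" using word_value_closed by (auto simp: lang_def)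
  show "carrier G \<subseteq> word_value G ` lang"
  proof
    fix g assume g: "g \<in> carrier G"
    then obtain w where "w \<in> lists A" "good {inv g} w" "inv (word_value G w) = inv g"
      using good_exists[OF sphere_clique_singleton[OF one_closed, of "inv g"]] by blast
    moreover from this have "word_value G w = g" using g word_value_closed inv_inj
      by (metis inv_inv)
    ultimately show "g \<in> word_value G ` lang" by (auto simp: lang_def)
  qed
qed

lemma lang_fellow_travel:
  assumes "u \<in> lang" "v \<in> lang" "g \<in> carrier G" "h \<in> carrier G"
    and start: "cayley_dist G A g h \<le> 1"
    and stop: "cayley_dist G A (path_at G g u (length u)) (path_at G h v (length v)) \<le> 1"
  shows "fellow_travel G A 5 g u h v"
  unfolding fellow_travel_def
proof
  fix t
  let ?u = "g \<otimes> word_value G u" and ?v = "h \<otimes> word_value G v"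
  have carr: "?u \<in> carrier G" "?v \<in> carrier G"
    using assms word_value_closed by (auto simp: lang_def)
  have gh: "adj g h" using start assms(3,4) d_adj cayley_dist_eq by simp
  have uv: "adj ?u ?v" using stop carr d_adj cayley_dist_eq by (simp add: path_at_def)
  let ?p = "path_at G g u t" and ?q = "path_at G h v t"
  have p: "?p \<in> itinerary ?u g t" and q: "?q \<in> itinerary ?v h t" using lang_itinerary assms by auto
  obtain r where r: "r \<in> itinerary ?u h t"
    using itinerary_clique[OF carr(1) assms(4), of t] by (auto simp: sphere_clique_def)
  have V: "?p \<in> carrier G" "?q \<in> carrier G" "r \<in> carrier G"
    using itinerary_V p q r carr assms(3,4) by blast+
  have "dist ?p r \<le> 3" by (rule itinerary_adjacent_starts[OF gh carr(1) p r])
  moreover have "dist r ?q \<le> 2" by (rule itinerary_adjacent_targets[OF uv assms(4) r q])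
  ultimately show "cayley_dist G A ?p ?q \<le> 5"
    using d_triangle[OF V(1,3,2)] cayley_dist_eq V by simp
qed

section \<open>Regularity: length-changing directions as states\<close>

definition lower :: "'a \<Rightarrow> 'a set" where
  "lower x = {a \<in> A. len (x \<otimes> a) < len x}"

definition common :: "'a \<Rightarrow> 'a set \<Rightarrow> 'a set" where
  "common y B = {h \<in> A. len (y \<otimes> h) = len y \<and> (\<forall>b\<in>B. inv b \<otimes> h \<in> A)}"

text \<open>A nontrivial flat edge has a common lower neighbour, and conversely a neighbour of a
  lower neighbour is not further away. So the shortening directions determine the flat ones, and
  with them the lengthening ones.\<close>

lemma flat_iff:
  assumes "y \<in> carrier G" "h \<in> A"
  shows "len (y \<otimes> h) = len y \<longleftrightarrow>
    h \<notin> lower y \<and> (h = \<one> \<or> (\<exists>q\<in>lower y. inv q \<otimes> h \<in> A))"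
proof
  assume eq: "len (y \<otimes> h) = len y"
  have "h = \<one> \<or> (\<exists>q\<in>lower y. inv q \<otimes> h \<in> A)"
  proof (cases "len y = 0")
    case True
    then have "y \<otimes> h = y" using eq len_zero[of y] len_zero[of "y \<otimes> h"] assms gens_closed by simp
    then show ?thesis using assms gens_closed by simp
  next
    case False
    then show ?thesis using len_flat[OF assms eq] by (auto simp: lower_def)
  qed
  then show "h \<notin> lower y \<and> (h = \<one> \<or> (\<exists>q\<in>lower y. inv q \<otimes> h \<in> A))"
    using eq by (simp add: lower_def)
next
  assume *: "h \<notin> lower y \<and> (h = \<one> \<or> (\<exists>q\<in>lower y. inv q \<otimes> h \<in> A))"
  then consider "h = \<one>" | q where "q \<in> lower y" "inv q \<otimes> h \<in> A" by blast
  then show "len (y \<otimes> h) = len y"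
  proof cases
    case 1
    then show ?thesis using assms by simp
  next
    case 2
    then have q: "q \<in> carrier G" "len (y \<otimes> q) < len y" using gens_closed by (auto simp: lower_def)
    have "y \<otimes> h = y \<otimes> q \<otimes> (inv q \<otimes> h)"
      using q assms gens_closed by (simp add: m_assoc mult_inv_cancel)
    then have "len (y \<otimes> h) \<le> Suc (len (y \<otimes> q))" using len_step[OF _ 2(2), of "y \<otimes> q"] q assms by simp
    then show ?thesis using q * assms by (simp add: lower_def)
  qed
qed

lemma len_up: "y \<in> carrier G \<Longrightarrow> b \<in> A \<Longrightarrow>
    len (y \<otimes> b) = Suc (len y) \<longleftrightarrow> b \<notin> lower y \<and> len (y \<otimes> b) \<noteq> len y"
  using len_step[of y b] by (auto simp: lower_def)

text \<open>The vertex \<open>y\<close> and any lower neighbour of \<open>y \<otimes> b\<close> both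
  lie below \<open>y \<otimes> b\<close>, hence are adjacent, and the step between them is flat. By
  \<open>flat_iff\<close> the set \<open>lower y\<close> thus determines
  \<open>lower (y \<otimes> b)\<close>; it plays the part of a cone type.\<close>

lemma lower_up:
  assumes y: "y \<in> carrier G" and b: "b \<in> A" and up: "len (y \<otimes> b) = Suc (len y)"
  shows "lower (y \<otimes> b) = {e \<in> A. b \<otimes> e \<in> A \<and> len (y \<otimes> (b \<otimes> e)) = len y}"
proof (intro equalityI subsetI)
  fix e assume "e \<in> lower (y \<otimes> b)"
  then have e: "e \<in> A" "len (y \<otimes> b \<otimes> e) < len (y \<otimes> b)" by (auto simp: lower_def)
  have carr: "b \<in> carrier G" "e \<in> carrier G" using b e gens_closed by auto
  have "b \<otimes> e \<in> A"
    using len_clique[of "y \<otimes> b" "inv b" e] e b up y carr gens_inv by (simp add: m_assoc)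
  moreover have "y \<otimes> b \<otimes> e \<otimes> inv e = y \<otimes> b" using y carr by (simp add: m_assoc)
  then have "len (y \<otimes> b) \<le> Suc (len (y \<otimes> b \<otimes> e))"
    using len_step[of "y \<otimes> b \<otimes> e" "inv e"] y e carr gens_inv by simp
  ultimately show "e \<in> {e \<in> A. b \<otimes> e \<in> A \<and> len (y \<otimes> (b \<otimes> e)) = len y}"
    using e up y carr by (simp add: m_assoc)
next
  fix e assume "e \<in> {e \<in> A. b \<otimes> e \<in> A \<and> len (y \<otimes> (b \<otimes> e)) = len y}"
  then show "e \<in> lower (y \<otimes> b)" using up y b gens_closed by (simp add: lower_def m_assoc)
qed

text \<open>Since \<open>y\<close> belongs to the projection, which is a clique, all of the
  projection is reached from \<open>y\<close> by generators.\<close>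

lemma proj_up:
  assumes y: "y \<in> carrier G" and B: "B \<subseteq> A" "B \<noteq> {}"
    and up: "\<And>b. b \<in> B \<Longrightarrow> len (y \<otimes> b) = Suc (len y)"
  shows "proj \<one> ((\<otimes>) y ` B) = (\<otimes>) y ` common y B"
proof (intro equalityI subsetI)
  fix z assume z: "z \<in> proj \<one> ((\<otimes>) y ` B)"
  obtain b where b: "b \<in> B" using B by blast
  have bc: "b \<in> A" "b \<in> carrier G" using b B gens_closed by auto
  have "adj (y \<otimes> b) z" "Suc (dist \<one> z) = dist \<one> (y \<otimes> b)" using z b by (auto simp: proj_def)
  then have zc: "z \<in> carrier G" "len z = len y" "adj (y \<otimes> b) z"
    using up[OF b] bc y dist_one[of "y \<otimes> b"] dist_one[of z] by (auto simp: adj_def)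
  have "adj (y \<otimes> b) y" using bc y gens_inv by (simp add: adj_def inv_mult_group m_assoc)
  then have yz: "inv y \<otimes> z \<in> A"
    using lower_clique[OF one_closed _ zc(3), of y "len y"] up[OF b] bc y zc dist_one
    by (simp add: adj_def)
  have "inv b' \<otimes> (inv y \<otimes> z) \<in> A" if "b' \<in> B" for b'
  proof -
    have "adj (y \<otimes> b') z" using z that by (auto simp: proj_def)
    then show ?thesis using y zc that B gens_closed by (auto simp: adj_def inv_mult_group m_assoc)
  qed
  then have "inv y \<otimes> z \<in> common y B"
    using yz y zc by (simp add: common_def mult_inv_cancel)
  then show "z \<in> (\<otimes>) y ` common y B" using mult_inv_cancel[OF y zc(1)] by (metis imageI)
next
  fix z assume "z \<in> (\<otimes>) y ` common y B"
  then obtain h where h: "h \<in> common y B" "z = y \<otimes> h" by blast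
  then have hA: "h \<in> A" "h \<in> carrier G" using gens_closed by (auto simp: common_def)
  show "z \<in> proj \<one> ((\<otimes>) y ` B)" unfolding proj_def
  proof (intro CollectI ballI)
    fix x assume "x \<in> (\<otimes>) y ` B"
    then obtain b where b: "b \<in> B" "x = y \<otimes> b" by blast
    have "b \<in> carrier G" using b B gens_closed by auto
    then show "adj x z \<and> Suc (dist \<one> z) = dist \<one> x"
      using h hA b up[OF b(1)] y by (auto simp: adj_def common_def inv_mult_translate dist_one)
  qed
qed

definition transition :: "'a \<Rightarrow> 'a set \<Rightarrow> 'a \<Rightarrow> bool" where
  "transition y B a \<longleftrightarrow> y \<in> carrier G \<and> a \<in> A \<and> inv a \<in> B \<and> B \<subseteq> A \<and>
     (\<forall>b\<in>B. len (y \<otimes> b) = Suc (len y)) \<and> (\<forall>b\<in>B. \<forall>b'\<in>B. inv b \<otimes> b' \<in> A)"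

text \<open>When a path towards \<open>\<one>\<close> reads the letter \<open>a\<close> and arrives at \<open>y\<close>, it passes from the simplex
  \<open>y B\<close> to its projection \<open>y (common y B)\<close>. A state consists of the directions which decrease the
  length and of the current simplex, seen from the current vertex; the latter determines
  the former along the whole path, read backwards from \<open>\<one>\<close>.\<close>

definition transitions :: "(('a set \<times> 'a set) \<times> 'a \<times> ('a set \<times> 'a set)) set" where
  "transitions = {((lower (y \<otimes> inv a), (\<otimes>) a ` B), a, (lower y, common y B)) | y B a. transition y B a}"

lemma lower_one: "lower \<one> = {}"
  by (simp add: lower_def len_one)

lemma good_accepts:
  "w \<in> lists A \<Longrightarrow> good \<sigma> w \<Longrightarrow> x = inv (word_value G w) \<Longrightarrow> sphere_clique \<one> (len x) \<sigma> \<Longrightarrow>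
    accepts transitions {({}, {\<one>})} (lower x, (\<otimes>) (inv x) ` \<sigma>) w"
proof (induction w arbitrary: \<sigma> x)
  case Nil
  then show ?case by (simp add: word_value_Nil lower_one)
next
  case (Cons a w)
  define y where "y = inv (word_value G w)"
  have wA: "w \<in> lists A" and a: "a \<in> A" "a \<in> carrier G" using Cons.prems gens_closed by auto
  have y: "y \<in> carrier G" "x = y \<otimes> inv a"
    using word_value_closed[OF wA] a Cons.prems(3) by (simp_all add: y_def word_value_Cons inv_mult_group)
  have good: "x \<in> \<sigma>" "good (proj \<one> \<sigma>) w" using Cons.prems by simp_all
  have yp: "y \<in> proj \<one> \<sigma>" using good_mem[OF good(2)] by (simp add: y_def)
  have lev: "adj s y \<and> len s = Suc (len y)" if "s \<in> \<sigma>" for s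
    using yp that y dist_one[of s] dist_one[of y] sphere_clique_V[OF Cons.prems(4) that]
    by (auto simp: proj_def)
  have sc: "s \<in> carrier G" if "s \<in> \<sigma>" for s using sphere_clique_V[OF Cons.prems(4) that] .
  define B where "B = (\<otimes>) (inv y) ` \<sigma>"
  have \<sigma>: "\<sigma> = (\<otimes>) y ` B"
    using mult_inv_cancel[OF y(1) sc] by (force simp: B_def image_image)
  have tr: "transition y B a" unfolding transition_def
  proof (intro conjI ballI)
    show "inv a \<in> B"
      unfolding B_def using good(1) y(2) a inv_mult_cancel[OF y(1), of "inv a"]
      by (metis image_eqI inv_closed)
    show "B \<subseteq> A" using lev adj_sym by (auto simp: B_def adj_def)
    show "len (y \<otimes> b) = Suc (len y)" if "b \<in> B" for b using lev that \<sigma> by blast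
    show "inv b \<otimes> b' \<in> A" if bb: "b \<in> B" "b' \<in> B" for b b'
    proof -
      obtain s s' where s: "s \<in> \<sigma>" "s' \<in> \<sigma>" "b = inv y \<otimes> s" "b' = inv y \<otimes> s'"
        using bb by (auto simp: B_def)
      have "adj s s'" using Cons.prems(4) s by (auto simp: sphere_clique_def)
      then show ?thesis using s y inv_mult_translate[of "inv y"] by (simp add: adj_def)
    qed
  qed (use y a in auto)
  have "len x = Suc (len y)" using lev good(1) by blast
  then have "sphere_clique \<one> (len y) (proj \<one> \<sigma>)" using sphere_clique_proj Cons.prems(4) by simp
  then have "accepts transitions {({}, {\<one>})} (lower y, (\<otimes>) (inv y) ` proj \<one> \<sigma>) w"
    using Cons.IH[OF wA good(2) y_def] by blast
  moreover have "proj \<one> \<sigma> = (\<otimes>) y ` common y B"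
    unfolding \<sigma> using tr by (intro proj_up) (auto simp: transition_def)
  then have "(\<otimes>) (inv y) ` proj \<one> \<sigma> = common y B"
    using inv_mult_cancel[OF y(1)] gens_closed by (force simp: image_image common_def)
  moreover have "(\<otimes>) (inv x) ` \<sigma> = (\<otimes>) a ` B"
    using y a sc by (auto simp: B_def image_image inv_mult_group m_assoc intro!: image_cong)
  ultimately show ?case using tr y(2) unfolding accepts.simps transitions_def by force
qed

text \<open>A transition may be justified by a vertex \<open>z\<close> unrelated to the actual
  vertex \<open>y\<close>. Induction from the end of the word shows that both have the same
  shortening directions, and by \<open>flat_iff\<close>, \<open>lower_up\<close> and
  \<open>proj_up\<close> the transition depends on nothing else of the vertex.\<close>

lemma accepts_good:
  "accepts transitions {({}, {\<one>})} q w \<Longrightarrow> w \<in> lists A \<Longrightarrow> x = inv (word_value G w) \<Longrightarrow>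
    fst q = lower x \<and> good ((\<otimes>) x ` snd q) w \<and> snd q \<subseteq> A"
proof (induction w arbitrary: q x)
  case Nil
  then show ?case using gens_one by (simp add: word_value_Nil lower_one)
next
  case (Cons a w)
  define y where "y = inv (word_value G w)"
  have wA: "w \<in> lists A" and a: "a \<in> A" "a \<in> carrier G" using Cons.prems gens_closed by auto
  have y: "y \<in> carrier G" "x = y \<otimes> inv a"
    using word_value_closed[OF wA] a Cons.prems(3) by (simp_all add: y_def word_value_Cons inv_mult_group)
  obtain z B where tr: "transition z B a" and q: "q = (lower (z \<otimes> inv a), (\<otimes>) a ` B)"
    and acc: "accepts transitions {({}, {\<one>})} (lower z, common z B) w"
    using Cons.prems(1) by (auto simp: transitions_def)
  have zB: "z \<in> carrier G" "inv a \<in> B" "B \<subseteq> A" using tr by (auto simp: transition_def)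
  have low: "lower z = lower y" and gd: "good ((\<otimes>) y ` common z B) w"
    using Cons.IH[OF acc wA y_def] by auto
  have flat: "len (z \<otimes> h) = len z \<longleftrightarrow> len (y \<otimes> h) = len y" if "h \<in> A" for h
    using flat_iff[OF zB(1) that] flat_iff[OF y(1) that] low by simp
  have up: "len (y \<otimes> b) = Suc (len y)" "len (z \<otimes> b) = Suc (len z)" if "b \<in> B" for b
  proof -
    have b: "b \<in> A" using that zB by blast
    show z: "len (z \<otimes> b) = Suc (len z)" using tr that by (simp add: transition_def)
    show "len (y \<otimes> b) = Suc (len y)"
      using z len_up[OF zB(1) b] len_up[OF y(1) b] flat[OF b] low by simp
  qed
  have "common z B = common y B" using flat by (auto simp: common_def)
  then have "good (proj \<one> ((\<otimes>) y ` B)) w"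
    using gd proj_up[OF y(1) zB(3) _ up(1)] zB(2) by (metis empty_iff)
  moreover have "(\<otimes>) x ` (\<otimes>) a ` B = (\<otimes>) y ` B"
    using y a zB(3) gens_closed by (auto simp: image_image m_assoc inv_mult_cancel intro!: image_cong)
  moreover have "x \<in> (\<otimes>) y ` B" using y zB by blast
  moreover have "lower (z \<otimes> inv a) = lower x"
    using lower_up[OF zB(1) _ up(2)[OF zB(2)]] lower_up[OF y(1) _ up(1)[OF zB(2)]] zB flat y(2) by blast
  moreover have "(\<otimes>) a ` B \<subseteq> A" using tr a zB by (force simp: transition_def)
  ultimately show ?case using q Cons.prems(3) by simp
qed

lemma regular_lang: "regular_language A lang"
proof -
  \<comment> \<open>The shortening directions at the start are guessed; the initial simplex, seen
    from its only vertex, is \<open>{\<one>}\<close>.\<close>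
  let ?Q = "Pow A \<times> Pow A" and ?I = "Pow A \<times> {{\<one>}}"
  have "lang = {w \<in> lists A. \<exists>q\<in>?I. accepts transitions {({}, {\<one>})} q w}"
  proof (intro equalityI subsetI)
    fix w assume "w \<in> lang"
    then have w: "w \<in> lists A" "good {inv (word_value G w)} w" by (auto simp: lang_def)
    let ?x = "inv (word_value G w)"
    have x: "?x \<in> carrier G" using word_value_closed w by simp
    have "sphere_clique \<one> (len ?x) {?x}" using sphere_clique_singleton[OF one_closed x] x dist_one by simp
    then have "accepts transitions {({}, {\<one>})} (lower ?x, {\<one>}) w"
      using good_accepts[OF w HOL.refl] x by simp
    moreover have "lower ?x \<subseteq> A" by (auto simp: lower_def)
    ultimately show "w \<in> {w \<in> lists A. \<exists>q\<in>?I. accepts transitions {({}, {\<one>})} q w}" using w by auto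
  next
    fix w assume "w \<in> {w \<in> lists A. \<exists>q\<in>?I. accepts transitions {({}, {\<one>})} q w}"
    then obtain D where w: "w \<in> lists A" "accepts transitions {({}, {\<one>})} (D, {\<one>}) w" by auto
    then show "w \<in> lang" using accepts_good[OF w(2,1) HOL.refl] word_value_closed by (simp add: lang_def)
  qed
  moreover have "regular_language A {w \<in> lists A. \<exists>q\<in>?I. accepts transitions {({}, {\<one>})} q w}"
    by (rule regular_language_accepts[of ?Q])
      (use gens gens_one in \<open>auto simp: transitions_def lower_def common_def\<close>)
  ultimately show ?thesis by simp
qed

lemma generate_gens: "generate G A = carrier G"
proof
  show "generate G A \<subseteq> carrier G" using generate_incl gens by blast
  have "word_value G w \<in> generate G A" if "w \<in> lists A" for w
    using that by (induction w) (auto simp: word_value_Nil word_value_Cons intro: generate.intros)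
  then show "carrier G \<subseteq> generate G A" using ex_geodesic_word by blast
qed

theorem biautomatic: "biautomatic G"
  unfolding biautomatic_def
proof (intro conjI exI[of _ A] exI[of _ lang] exI[of _ 5])
  show "\<forall>u\<in>lang. \<forall>v\<in>lang. \<forall>g\<in>carrier G. \<forall>h\<in>carrier G. cayley_dist G A g h \<le> 1 \<and>
      cayley_dist G A (path_at G g u (length u)) (path_at G h v (length v)) \<le> 1 \<longrightarrow>
      fellow_travel G A 5 g u h v"
    using lang_fellow_travel by simp
qed (use gens gens_inv generate_gens regular_lang lang_surj is_group in simp_all)

end

section \<open>The universal group of a finite pree\<close>

lemma (in pree46) bridged_group_U:
  assumes "finite (carrier P)"
  shows "bridged_group U (gen ` carrier P) len"
proof (rule bridged_group.intro[OF group_universal_group], rule bridged_group_axioms.intro)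
  show "finite (gen ` carrier P)" "gen ` carrier P \<subseteq> carrier U"
    using assms gen_closed by auto
  show "inv\<^bsub>U\<^esub> a \<in> gen ` carrier P" if "a \<in> gen ` carrier P" for a
    using that pinv_carrier by (auto simp: gen_pinv[symmetric])
  show "\<one>\<^bsub>U\<^esub> \<in> gen ` carrier P" unfolding gen_one[symmetric] by (rule imageI[OF one_closed])
  show "len g = 0 \<longleftrightarrow> g = \<one>\<^bsub>U\<^esub>" if g: "g \<in> carrier U" for g
  proof
    assume "len g = 0"
    then show "g = \<one>\<^bsub>U\<^esub>" using len_edge[OF g] val_Nil by (metis length_0_conv)
  qed (use len_val[OF Nil_vertices] val_Nil in simp)
  show "len (g \<otimes>\<^bsub>U\<^esub> a) \<le> Suc (len g)" if g: "g \<in> carrier U" and a: "a \<in> gen ` carrier P" for g a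
  proof -
    obtain x where "x \<in> carrier P" "a = gen x" using a by blast
    then show ?thesis using len_edge[OF g] edge_level by metis
  qed
  show "\<exists>a\<in>gen ` carrier P. len (g \<otimes>\<^bsub>U\<^esub> a) < len g" if g: "g \<in> carrier U" "0 < len g" for g
  proof -
    obtain u where u: "u \<in> vertices" "len g = length u" "val u = g" using len_edge[OF g(1)] by metis
    then obtain w p where wp: "u = w @ [p]" using g(2) by (cases u rule: rev_cases) auto
    have e: "edge w p u" using vertices_prefix u wp by simp
    have dom: "w \<in> vertices" "p \<in> carrier P" using edge_dom[OF e] by auto
    have "g \<otimes>\<^bsub>U\<^esub> gen (pinv P p) = val w" using edge_val[OF edge_sym[OF e]] u by simp
    then have "len (g \<otimes>\<^bsub>U\<^esub> gen (pinv P p)) < len g" using len_val[OF dom(1)] u wp by simp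
    then show ?thesis using pinv_carrier[OF dom(2)] by blast
  qed
  show "inv\<^bsub>U\<^esub> a \<otimes>\<^bsub>U\<^esub> b \<in> gen ` carrier P"
    if g: "g \<in> carrier U" and ab: "a \<in> gen ` carrier P" "b \<in> gen ` carrier P"
      and l: "len (g \<otimes>\<^bsub>U\<^esub> a) < len g" "len (g \<otimes>\<^bsub>U\<^esub> b) < len g" for g a b
  proof -
    obtain x y where xy: "x \<in> carrier P" "a = gen x" "y \<in> carrier P" "b = gen y" using ab by blast
    obtain u where u: "len g = length u"
      "\<And>x. x \<in> carrier P \<Longrightarrow> \<exists>t. edge u x t \<and> len (g \<otimes>\<^bsub>U\<^esub> gen x) = length t"
      using len_edge[OF g] by metis
    obtain t v where "edge u x t" "length t < length u" "edge u y v" "length v < length u"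
      using u(2)[OF xy(1)] u(2)[OF xy(3)] l u(1) xy(2,4) by auto
    then have "linked x y" using edge_down by blast
    then show ?thesis using gen_linked xy by simp
  qed
  show "\<exists>b\<in>gen ` carrier P. len (g \<otimes>\<^bsub>U\<^esub> b) < len g \<and> inv\<^bsub>U\<^esub> b \<otimes>\<^bsub>U\<^esub> a \<in> gen ` carrier P"
    if g: "g \<in> carrier U" and a: "a \<in> gen ` carrier P"
      and l: "len (g \<otimes>\<^bsub>U\<^esub> a) = len g" "0 < len g" for g a
  proof -
    obtain x where x: "x \<in> carrier P" "a = gen x" using a by blast
    obtain u where u: "val u = g" "len g = length u"
      "\<And>x. x \<in> carrier P \<Longrightarrow> \<exists>t. edge u x t \<and> len (g \<otimes>\<^bsub>U\<^esub> gen x) = length t"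
      using len_edge[OF g] by metis
    obtain t where t: "edge u x t" "length t = length u" using u(3)[OF x(1)] l u(2) x(2) by auto
    obtain y v where y: "edge u y v" "length v < length u" "linked y x"
      using edge_flat[OF t] l(2) u(2) by auto
    have dom: "y \<in> carrier P" "v \<in> vertices" using edge_dom[OF y(1)] by auto
    have "len (g \<otimes>\<^bsub>U\<^esub> gen y) < len g"
      using edge_val[OF y(1)] len_val[OF dom(2)] y(2) u by simp
    then show ?thesis using gen_linked[OF dom(1) x(1)] y(3) x(2) dom(1) by blast
  qed
  show "inv\<^bsub>U\<^esub> a \<otimes>\<^bsub>U\<^esub> c \<in> gen ` carrier P \<or> inv\<^bsub>U\<^esub> b \<otimes>\<^bsub>U\<^esub> e \<in> gen ` carrier P"
    if mem: "a \<in> gen ` carrier P" "b \<in> gen ` carrier P" "c \<in> gen ` carrier P" "e \<in> gen ` carrier P"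
      and lk: "inv\<^bsub>U\<^esub> a \<otimes>\<^bsub>U\<^esub> b \<in> gen ` carrier P" "inv\<^bsub>U\<^esub> b \<otimes>\<^bsub>U\<^esub> c \<in> gen ` carrier P"
      "inv\<^bsub>U\<^esub> c \<otimes>\<^bsub>U\<^esub> e \<in> gen ` carrier P" "inv\<^bsub>U\<^esub> e \<otimes>\<^bsub>U\<^esub> a \<in> gen ` carrier P"
    for a b c e
  proof -
    obtain x y z w where xs: "a = gen x" "b = gen y" "c = gen z" "e = gen w"
      and carr: "x \<in> carrier P" "y \<in> carrier P" "z \<in> carrier P" "w \<in> carrier P"
      using mem by (elim imageE)
    have "linked x y" "linked y z" "linked z w" "linked w x"
      using lk gen_linked carr unfolding xs by blast+
    then show ?thesis
      unfolding xs gen_linked[OF carr(1,3)] gen_linked[OF carr(2,4)]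
      by (rule linked_cycle4[OF axiom_A4])
  qed
  show "inv\<^bsub>U\<^esub> a \<otimes>\<^bsub>U\<^esub> c \<in> gen ` carrier P \<or> inv\<^bsub>U\<^esub> b \<otimes>\<^bsub>U\<^esub> e \<in> gen ` carrier P \<or>
      inv\<^bsub>U\<^esub> c \<otimes>\<^bsub>U\<^esub> f \<in> gen ` carrier P \<or> inv\<^bsub>U\<^esub> e \<otimes>\<^bsub>U\<^esub> a \<in> gen ` carrier P \<or>
      inv\<^bsub>U\<^esub> f \<otimes>\<^bsub>U\<^esub> b \<in> gen ` carrier P"
    if mem: "a \<in> gen ` carrier P" "b \<in> gen ` carrier P" "c \<in> gen ` carrier P" "e \<in> gen ` carrier P"
      "f \<in> gen ` carrier P"
      and lk: "inv\<^bsub>U\<^esub> a \<otimes>\<^bsub>U\<^esub> b \<in> gen ` carrier P" "inv\<^bsub>U\<^esub> b \<otimes>\<^bsub>U\<^esub> c \<in> gen ` carrier P"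
      "inv\<^bsub>U\<^esub> c \<otimes>\<^bsub>U\<^esub> e \<in> gen ` carrier P" "inv\<^bsub>U\<^esub> e \<otimes>\<^bsub>U\<^esub> f \<in> gen ` carrier P"
      "inv\<^bsub>U\<^esub> f \<otimes>\<^bsub>U\<^esub> a \<in> gen ` carrier P" for a b c e f
  proof -
    obtain x y z w v where xs: "a = gen x" "b = gen y" "c = gen z" "e = gen w" "f = gen v"
      and carr: "x \<in> carrier P" "y \<in> carrier P" "z \<in> carrier P" "w \<in> carrier P" "v \<in> carrier P"
      using mem by (elim imageE)
    have "linked x y" "linked y z" "linked z w" "linked w v" "linked v x"
      using lk gen_linked carr unfolding xs by blast+
    then show ?thesis
      unfolding xs gen_linked[OF carr(1,3)] gen_linked[OF carr(2,4)] gen_linked[OF carr(3,5)]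
        gen_linked[OF carr(4,1)] gen_linked[OF carr(5,2)]
      by (rule linked_cycle5[OF axiom_A5])
  qed
qed

theorem theorem4p5:
  fixes P :: "('a, 'more) partial_magma_scheme"
  assumes "pree P" and "finite (carrier P)"
    and "axiom_A P 4" and "axiom_A P 5"
  shows "biautomatic (universal_group P)"
proof -
  interpret pree46 P using assms by (simp add: pree46_def pree46_axioms_def)
  show ?thesis using bridged_group.biautomatic[OF bridged_group_U[OF assms(2)]] .
qed

end
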